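(* $c_0(M_n)$ has the $2$-CSEP, for all $n$.
   Context: $M_n$ denotes the $n\times n$ complex matrices, identified with $\mathcal L(\ell^2_n)$. For fixed $n$, $c_0(M_n)$ is the operator space of sequences in $M_n$ tending to $0$ in norm, with sup norm and matrix norms given by suprema over coordinates. An operator space $Z$ has the $\lambda$-CSEP ($\lambda$-Complete Separable Extension Property) if for all separable operator spaces $Y$, all closed linear subspaces $X\subset Y$, and all completely bounded operators $T:X\to Z$, there exists a completely bounded $\tilde T:Y\to Z$ extending $T$ with $\|\tilde T\|_{cb}\le\lambda\|T\|_{cb}$. *)

theory Defs
  imports "HOL-Analysis.Analysis" "HOL-Library.Function_Algebras"
begin

text \<open>
  Operator spaces are complete complex matrix-normed spaces satisfying Ruan's axioms; in
  particular every closed linear subspace of the bounded operators on a Hilbert space, with its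
  inherited matrix norms, is one.  The libraries have no class of complex normed spaces, so a
  space is a record of its underlying set, its complex scalar multiplication and its matrix
  norms; addition is that of the ambient type.  An m-by-m matrix is a function on pairs of
  naturals of which only the entries with both indices below m matter; that the matrix norm
  ignores the other entries follows from definiteness and the triangle inequality.
\<close>

record 'a op_space =
  space_carrier :: "'a set"
  scl :: "complex \<Rightarrow> 'a \<Rightarrow> 'a"
  mnorm :: "nat \<Rightarrow> (nat \<Rightarrow> nat \<Rightarrow> 'a) \<Rightarrow> real"

definition matrices_over :: "'a op_space \<Rightarrow> nat \<Rightarrow> (nat \<Rightarrow> nat \<Rightarrow> 'a) set" where
  "matrices_over V m = {x. \<forall>i<m. \<forall>j<m. x i j \<in> space_carrier V}"

definition vnorm :: "'a op_space \<Rightarrow> 'a \<Rightarrow> real" where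
  "vnorm V v = mnorm V 1 (\<lambda>i j. v)"

text \<open>
  The value off the carrier is irrelevant; it is fixed to 0 because the locale
  \<^locale>\<open>Metric_space\<close> wants a distance that is symmetric and nonnegative on the whole type.
\<close>

definition vdist :: "'a::ab_group_add op_space \<Rightarrow> 'a \<Rightarrow> 'a \<Rightarrow> real" where
  "vdist V v w =
    (if v \<in> space_carrier V \<and> w \<in> space_carrier V then vnorm V (v - w) else 0)"

abbreviation vtopology :: "'a::ab_group_add op_space \<Rightarrow> 'a topology" where
  "vtopology V \<equiv> Metric_space.mtopology (space_carrier V) (vdist V)"

text \<open>Norm of a p-by-q scalar matrix as an operator from q-dimensional to p-dimensional
  Hilbert space.\<close>

definition scalar_mat_norm :: "nat \<Rightarrow> nat \<Rightarrow> (nat \<Rightarrow> nat \<Rightarrow> complex) \<Rightarrow> real" where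
  "scalar_mat_norm p q a =
    Sup {L2_set (\<lambda>i. cmod (\<Sum>j<q. a i j * v j)) {..<p} | v. L2_set (\<lambda>j. cmod (v j)) {..<q} \<le> 1}"

definition mat_sandwich ::
  "'a::ab_group_add op_space \<Rightarrow> nat \<Rightarrow> (nat \<Rightarrow> nat \<Rightarrow> complex) \<Rightarrow> (nat \<Rightarrow> nat \<Rightarrow> 'a)
    \<Rightarrow> (nat \<Rightarrow> nat \<Rightarrow> complex) \<Rightarrow> nat \<Rightarrow> nat \<Rightarrow> 'a" where
  "mat_sandwich V p a x b = (\<lambda>i j. \<Sum>k<p. \<Sum>l<p. scl V (a i k * b l j) (x k l))"

definition mat_dsum ::
  "nat \<Rightarrow> (nat \<Rightarrow> nat \<Rightarrow> 'a::zero) \<Rightarrow> (nat \<Rightarrow> nat \<Rightarrow> 'a) \<Rightarrow> nat \<Rightarrow> nat \<Rightarrow> 'a" where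
  "mat_dsum p x y = (\<lambda>i j. if i < p \<and> j < p then x i j
                           else if p \<le> i \<and> p \<le> j then y (i - p) (j - p) else 0)"

locale operator_space =
  fixes V :: "'a::ab_group_add op_space"
  assumes vector_space_scl: "vector_space (scl V)"
    and subspace_carrier: "module.subspace (scl V) (space_carrier V)"
    and mnorm_triangle: "\<And>m x y. \<lbrakk>0 < m; x \<in> matrices_over V m; y \<in> matrices_over V m\<rbrakk>
      \<Longrightarrow> mnorm V m (\<lambda>i j. x i j + y i j) \<le> mnorm V m x + mnorm V m y"
    and mnorm_scl: "\<And>m c x. \<lbrakk>0 < m; x \<in> matrices_over V m\<rbrakk>
      \<Longrightarrow> mnorm V m (\<lambda>i j. scl V c (x i j)) = cmod c * mnorm V m x"
    and mnorm_eq_0_iff: "\<And>m x. \<lbrakk>0 < m; x \<in> matrices_over V m\<rbrakk>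
      \<Longrightarrow> mnorm V m x = 0 \<longleftrightarrow> (\<forall>i<m. \<forall>j<m. x i j = 0)"
    and mnorm_dsum: "\<And>p q x y. \<lbrakk>0 < p; 0 < q; x \<in> matrices_over V p; y \<in> matrices_over V q\<rbrakk>
      \<Longrightarrow> mnorm V (p + q) (mat_dsum p x y) = max (mnorm V p x) (mnorm V q y)"
    and mnorm_sandwich: "\<And>p q a x b. \<lbrakk>0 < p; 0 < q; x \<in> matrices_over V p\<rbrakk>
      \<Longrightarrow> mnorm V q (mat_sandwich V p a x b)
            \<le> scalar_mat_norm q p a * mnorm V p x * scalar_mat_norm p q b"
    and complete: "Metric_space.mcomplete (space_carrier V) (vdist V)"

definition separable_op_space :: "'a::ab_group_add op_space \<Rightarrow> bool" where
  "separable_op_space V \<longleftrightarrow> separable_space (vtopology V)"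

definition closed_linear_subspace :: "'a::ab_group_add set \<Rightarrow> 'a op_space \<Rightarrow> bool" where
  "closed_linear_subspace X V \<longleftrightarrow>
     X \<subseteq> space_carrier V \<and> module.subspace (scl V) X \<and> closedin (vtopology V) X"

abbreviation restrict_space_to :: "'a op_space \<Rightarrow> 'a set \<Rightarrow> 'a op_space" where
  "restrict_space_to V X \<equiv> V\<lparr>space_carrier := X\<rparr>"

text \<open>Operators are functions on the ambient type; only their values on the carrier matter.\<close>

definition linear_operator ::
  "'a::ab_group_add op_space \<Rightarrow> 'b::ab_group_add op_space \<Rightarrow> ('a \<Rightarrow> 'b) \<Rightarrow> bool" where
  "linear_operator V W T \<longleftrightarrow>
     T ` space_carrier V \<subseteq> space_carrier W \<and>
     (\<forall>x\<in>space_carrier V. \<forall>y\<in>space_carrier V. T (x + y) = T x + T y) \<and>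
     (\<forall>c. \<forall>x\<in>space_carrier V. T (scl V c x) = scl W c (T x))"

text \<open>The norms of all values of all amplifications of T on the unit balls of the matrix
  spaces.\<close>

definition amplification_values ::
  "'a op_space \<Rightarrow> 'b op_space \<Rightarrow> ('a \<Rightarrow> 'b) \<Rightarrow> real set" where
  "amplification_values V W T =
     {mnorm W m (\<lambda>i j. T (x i j)) | m x. 0 < m \<and> x \<in> matrices_over V m \<and> mnorm V m x \<le> 1}"

definition completely_bounded ::
  "'a::ab_group_add op_space \<Rightarrow> 'b::ab_group_add op_space \<Rightarrow> ('a \<Rightarrow> 'b) \<Rightarrow> bool" where
  "completely_bounded V W T \<longleftrightarrow> linear_operator V W T \<and> bdd_above (amplification_values V W T)"

definition cb_norm :: "'a op_space \<Rightarrow> 'b op_space \<Rightarrow> ('a \<Rightarrow> 'b) \<Rightarrow> real" where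
  "cb_norm V W T = Sup (amplification_values V W T)"

text \<open>
  HOL cannot quantify over types inside a definition, so the ambient type of the separable spaces
  is a parameter.  A theorem stating the property with this type left as a type variable covers
  all separable operator spaces.
\<close>

definition has_CSEP ::
  "'y::ab_group_add itself \<Rightarrow> real \<Rightarrow> 'z::ab_group_add op_space \<Rightarrow> bool" where
  "has_CSEP _ lam Z \<longleftrightarrow>
     operator_space Z \<and>
     (\<forall>(Y :: 'y op_space) X T.
        operator_space Y \<and> separable_op_space Y \<and> closed_linear_subspace X Y \<and>
        completely_bounded (restrict_space_to Y X) Z T \<longrightarrow>
        (\<exists>T'. completely_bounded Y Z T' \<and> (\<forall>x\<in>X. T' x = T x) \<and>
              cb_norm Y Z T' \<le> lam * cb_norm (restrict_space_to Y X) Z T))"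

text \<open>
  The n-by-n complex matrices, n being the cardinality of the index type, as operators on
  n-dimensional Hilbert space.  The library norm of \<^typ>\<open>complex^'n^'n\<close> is the
  Hilbert-Schmidt norm and is not used: an m-by-m matrix over this space is
  normed as an operator on the m-fold Hilbert sum of \<^typ>\<open>complex^'n\<close>.
\<close>

definition matrix_op_space :: "(complex^'n^'n) op_space" where
  "matrix_op_space =
     \<lparr>space_carrier = UNIV,
      scl = (\<lambda>c A. \<chi> i j. c * A $ i $ j),
      mnorm = (\<lambda>m A. Sup {L2_set (\<lambda>i. norm (\<Sum>j<m. A i j *v v j)) {..<m} | v.
                            L2_set (\<lambda>j. norm (v j)) {..<m} \<le> 1})\<rparr>"

definition c0_space :: "'a::ab_group_add op_space \<Rightarrow> (nat \<Rightarrow> 'a) op_space" where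
  "c0_space V =
     \<lparr>space_carrier = {f. (\<forall>k. f k \<in> space_carrier V) \<and> (\<lambda>k. vnorm V (f k)) \<longlonglongrightarrow> 0},
      scl = (\<lambda>c f k. scl V c (f k)),
      mnorm = (\<lambda>m x. SUP k. mnorm V m (\<lambda>i j. x i j k))\<rparr>"

end

theory Submission
  imports Defs
begin

text \<open>
  A completely bounded map \<open>T\<close> from \<open>X\<close> into \<open>c\<^sub>0(M\<^sub>n)\<close> is a sequence of maps
  \<open>T\<^sub>k\<close> from \<open>X\<close> into \<open>M\<^sub>n\<close> whose completely bounded norms are at most \<open>C = \<parallel>T\<parallel>\<close> and which
  tend to 0 at every point of \<open>X\<close>.  The proof extends the coordinates one by one and then
  corrects the extensions, so that they tend to 0 at every point of \<open>Y\<close>.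

  The coordinates extend because \<open>M\<^sub>n\<close> is an injective operator space (\<open>Wittstock_extension\<close>).
  A map \<open>T\<close> into \<open>M\<^sub>n\<close> is encoded by the functional that sends an n-by-n matrix \<open>u\<close> over \<open>X\<close> to
  the sum of the numbers \<open>(T u\<^sub>i\<^sub>j)\<^sub>i\<^sub>j\<close>.  The bound \<open>C\<close> for \<open>T\<close> amounts to the real part of
  the functional being at most \<open>C\<close> times a gauge: the infimum of half the sum of the squared
  Hilbert-Schmidt norms of \<open>a\<close> and \<open>b\<close>, over all factorizations \<open>u = a x b\<close> with \<open>x\<close> in the
  unit ball of some matrix space.  The Hahn-Banach theorem then extends the functional, and thus
  the map, provided the gauge of a matrix over \<open>X\<close> is the same whether \<open>x\<close> ranges over matrices
  with entries in \<open>X\<close> or in \<open>Y\<close>.  This holds by Gram-Schmidt orthonormalization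
  (\<open>orthonormal_row_factorization\<close>): it replaces the outer factors by n-by-n matrices and \<open>x\<close> by
  a compression of \<open>x\<close>, which is a combination of the entries of \<open>u\<close> and so has entries in \<open>X\<close>.

  The correction follows Veech's proof of Sobczyk's theorem
  (\<open>asymptotic_annihilating_approximants\<close>).  The maps from \<open>Y\<close> into \<open>M\<^sub>n\<close> with completely
  bounded norm at most \<open>C\<close> form a compact set for pointwise convergence, and every cluster point
  of a sequence of extensions \<open>S\<^sub>k\<close> vanishes on \<open>X\<close>, since \<open>T\<^sub>k\<close> tends to 0 there.  As \<open>Y\<close> is
  separable, there are maps \<open>R\<^sub>k\<close> in this set that vanish on \<open>X\<close> and satisfy
  \<open>S\<^sub>k y - R\<^sub>k y \<longlonglongrightarrow> 0\<close> for all \<open>y\<close> in \<open>Y\<close>.  The maps \<open>S\<^sub>k - R\<^sub>k\<close> are the coordinates of the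
  required extension; the factor 2 is the triangle inequality for \<open>S\<^sub>k - R\<^sub>k\<close>.

  That \<open>c\<^sub>0(M\<^sub>n)\<close> is an operator space at all is a part of the claim; it is obtained from the
  same statement for \<open>M\<^sub>n\<close> and the passage from an operator space to its null sequences.
\<close>

section \<open>Operator norms of scalar matrices and of block matrices\<close>

abbreviation l2 :: "nat \<Rightarrow> (nat \<Rightarrow> 'a::real_normed_vector) \<Rightarrow> real" where
  "l2 m v \<equiv> L2_set (\<lambda>j. norm (v j)) {..<m}"

text \<open>
  Homogeneity turns a supremum over a unit ball into an inequality on the whole space.  The bound
  \<open>K\<close> makes the supremum finite and handles vectors on which \<open>q\<close> vanishes.
\<close>
lemma le_Sup_unit_ball:
  fixes p q :: "'v \<Rightarrow> real" and s :: "real \<Rightarrow> 'v \<Rightarrow> 'v"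
  assumes p: "\<And>c v. c > 0 \<Longrightarrow> p (s c v) = c * p v"
    and q: "\<And>c v. c > 0 \<Longrightarrow> q (s c v) = c * q v"
    and q0: "\<And>v. q v \<ge> 0" and K: "\<And>v. p v \<le> K * q v"
  shows "p v \<le> Sup {p v | v. q v \<le> 1} * q v"
proof (cases "q v = 0")
  case True
  then show ?thesis using K[of v] by simp
next
  case False
  then have pos: "q v > 0" using q0[of v] by linarith
  have bdd: "bdd_above {p v | v. q v \<le> 1}"
  proof (rule bdd_aboveI[where M = "\<bar>K\<bar>"])
    fix t assume "t \<in> {p v | v. q v \<le> 1}"
    then obtain w where w: "t = p w" "q w \<le> 1" by blast
    have "K * q w \<le> \<bar>K\<bar> * 1"
      by (rule mult_mono) (use w q0 in auto)
    then show "t \<le> \<bar>K\<bar>" using K[of w] w by simp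
  qed
  have "p (s (1 / q v) v) \<in> {p v | v. q v \<le> 1}"
    using pos q[of "1 / q v" v] by auto
  then have "p (s (1 / q v) v) \<le> Sup {p v | v. q v \<le> 1}"
    using bdd by (rule cSup_upper)
  then show ?thesis using pos p[of "1 / q v" v] by (simp add: field_simps)
qed

lemma l2_scale: "l2 m (\<lambda>j. c *\<^sub>R v j) = \<bar>c\<bar> * l2 m v"
  by (simp add: L2_set_right_distrib)

lemma l2_le_iff:
  assumes "0 \<le> B"
  shows "l2 m v \<le> B \<longleftrightarrow> (\<Sum>j<m. (norm (v j))\<^sup>2) \<le> B\<^sup>2"
  unfolding L2_set_def using assms real_le_lsqrt sqrt_le_D real_sqrt_le_iff
  by (metis real_sqrt_abs abs_of_nonneg)

lemma l2_square: "(l2 m v)\<^sup>2 = (\<Sum>j<m. (norm (v j))\<^sup>2)"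
  unfolding L2_set_def by (simp add: sum_nonneg)

lemma norm_le_l2: "j < m \<Longrightarrow> norm (v j) \<le> l2 m v"
  using member_le_L2_set[of "{..<m}" j "\<lambda>j. norm (v j)"] by simp

lemma scalar_mat_apply_le:
  "l2 p (\<lambda>i. \<Sum>j<q. a i j * v j) \<le> scalar_mat_norm p q a * l2 q v"
  unfolding scalar_mat_norm_def
proof (rule le_Sup_unit_ball[where s = "\<lambda>c v j. c *\<^sub>R v j" and K = "\<Sum>i<p. \<Sum>j<q. cmod (a i j)"])
  fix c :: real and v :: "nat \<Rightarrow> complex" assume "c > 0"
  then show "l2 p (\<lambda>i. \<Sum>j<q. a i j * (c *\<^sub>R v j)) = c * l2 p (\<lambda>i. \<Sum>j<q. a i j * v j)"
    by (simp add: L2_set_right_distrib flip: scaleR_sum_right)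
  show "l2 q (\<lambda>j. c *\<^sub>R v j) = c * l2 q v"
    using l2_scale[of c v q] \<open>c > 0\<close> by simp
next
  fix v
  have "l2 p (\<lambda>i. \<Sum>j<q. a i j * v j) \<le> (\<Sum>i<p. norm (\<Sum>j<q. a i j * v j))"
    by (rule L2_set_le_sum) simp
  also have "\<dots> \<le> (\<Sum>i<p. \<Sum>j<q. cmod (a i j) * l2 q v)"
    by (intro sum_mono order_trans[OF norm_sum])
       (auto simp: norm_mult intro!: mult_left_mono norm_le_l2)
  finally show "l2 p (\<lambda>i. \<Sum>j<q. a i j * v j) \<le> (\<Sum>i<p. \<Sum>j<q. cmod (a i j)) * l2 q v"
    by (simp add: sum_distrib_right)
qed auto

lemma scalar_mat_norm_leI:
  assumes "\<And>v. l2 q v \<le> 1 \<Longrightarrow> l2 p (\<lambda>i. \<Sum>j<q. a i j * v j) \<le> B"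
  shows "scalar_mat_norm p q a \<le> B"
  unfolding scalar_mat_norm_def
proof (rule cSup_least)
  have z: "l2 q (\<lambda>_. 0::complex) \<le> 1" by (simp add: L2_set_def)
  show "{l2 p (\<lambda>i. \<Sum>j<q. a i j * v j) | v. l2 q v \<le> 1} \<noteq> {}"
    by (intro ex_in_conv[THEN iffD1] exI CollectI) (rule conjI[OF refl z])
qed (use assms in auto)

lemma scalar_mat_norm_nonneg: "0 \<le> scalar_mat_norm p q a"
proof (cases "q = 0")
  case True
  have "{l2 p (\<lambda>i. \<Sum>j<q. a i j * v j) | v. l2 q v \<le> 1} = {0}"
    using True by (auto simp: L2_set_def)
  then show ?thesis unfolding scalar_mat_norm_def by simp
next
  case False
  define v where "v = (\<lambda>j. if j = (0::nat) then 1 else 0 :: complex)"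
  \<comment> \<open>the norm dominates the length of the image of a unit vector\<close>
  have "(\<Sum>j<q. (norm (v j))\<^sup>2) = (\<Sum>j\<in>{0}. (norm (v j))\<^sup>2)"
    using False by (intro sum.mono_neutral_right) (auto simp: v_def)
  then have "l2 q v = 1" by (simp add: L2_set_def v_def)
  then show ?thesis
    using order_trans[OF L2_set_nonneg scalar_mat_apply_le[where p = p and q = q and a = a and v = v]] by simp
qed

abbreviation Mn :: "(complex^'n^'n) op_space" where "Mn \<equiv> matrix_op_space"

lemma Mn_simps [simp]:
  "space_carrier Mn = UNIV"
  "scl Mn c A $ r $ s = c * A $ r $ s"
  "matrices_over Mn m = UNIV"
  by (auto simp: matrix_op_space_def matrices_over_def)

lemma norm_matrix_vector_le_entries:
  fixes A :: "complex^'n^'n"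
  shows "norm (A *v x) \<le> (\<Sum>r\<in>UNIV. \<Sum>s\<in>UNIV. cmod (A $ r $ s)) * norm x"
proof -
  have "norm (A *v x) \<le> (\<Sum>r\<in>UNIV. norm ((A *v x) $ r))"
    unfolding norm_vec_def by (rule L2_set_le_sum) simp
  also have "\<dots> \<le> (\<Sum>r\<in>UNIV. \<Sum>s\<in>UNIV. cmod (A $ r $ s) * norm x)"
    unfolding matrix_vector_mult_def
    by (intro sum_mono)
       (auto simp: norm_mult Finite_Cartesian_Product.norm_nth_le intro!: mult_left_mono sum_norm_le)
  finally show ?thesis by (simp add: sum_distrib_right)
qed

lemma Mn_mnorm:
  "mnorm Mn m A = Sup {l2 m (\<lambda>i. \<Sum>j<m. A i j *v v j) | v. l2 m v \<le> 1}"
  by (simp add: matrix_op_space_def)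

lemma matrix_vector_mult_scaleR_right:
  fixes A :: "complex^'n^'n" shows "A *v (c *\<^sub>R x) = c *\<^sub>R (A *v x)"
  by (simp add: vec_eq_iff matrix_vector_mult_def scaleR_sum_right)

lemma Mn_apply_le:
  fixes A :: "nat \<Rightarrow> nat \<Rightarrow> complex^'n^'n"
  shows "l2 m (\<lambda>i. \<Sum>j<m. A i j *v v j) \<le> mnorm Mn m A * l2 m v"
  unfolding Mn_mnorm
proof (rule le_Sup_unit_ball[where s = "\<lambda>c v j. c *\<^sub>R v j"
      and K = "\<Sum>i<m. \<Sum>j<m. \<Sum>r\<in>UNIV. \<Sum>s\<in>UNIV. cmod (A i j $ r $ s)"])
  fix c :: real and v :: "nat \<Rightarrow> complex^'n" assume "c > 0"
  then show "l2 m (\<lambda>i. \<Sum>j<m. A i j *v (c *\<^sub>R v j)) = c * l2 m (\<lambda>i. \<Sum>j<m. A i j *v v j)"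
    by (simp add: L2_set_right_distrib matrix_vector_mult_scaleR_right flip: scaleR_sum_right)
  show "l2 m (\<lambda>j. c *\<^sub>R v j) = c * l2 m v"
    using l2_scale[of c v m] \<open>c > 0\<close> by simp
next
  fix v
  have "l2 m (\<lambda>i. \<Sum>j<m. A i j *v v j) \<le> (\<Sum>i<m. norm (\<Sum>j<m. A i j *v v j))"
    by (rule L2_set_le_sum) simp
  also have "\<dots> \<le> (\<Sum>i<m. \<Sum>j<m. (\<Sum>r\<in>UNIV. \<Sum>s\<in>UNIV. cmod (A i j $ r $ s)) * l2 m v)"
    by (intro sum_mono order_trans[OF norm_sum] order_trans[OF norm_matrix_vector_le_entries])
       (auto intro!: mult_left_mono norm_le_l2 sum_nonneg)
  finally show "l2 m (\<lambda>i. \<Sum>j<m. A i j *v v j)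
      \<le> (\<Sum>i<m. \<Sum>j<m. \<Sum>r\<in>UNIV. \<Sum>s\<in>UNIV. cmod (A i j $ r $ s)) * l2 m v"
    by (simp add: sum_distrib_right)
qed auto

lemma Mn_mnorm_leI:
  fixes A :: "nat \<Rightarrow> nat \<Rightarrow> complex^'n^'n"
  assumes "\<And>v. l2 m v \<le> 1 \<Longrightarrow> l2 m (\<lambda>i. \<Sum>j<m. A i j *v v j) \<le> B"
  shows "mnorm Mn m A \<le> B"
  unfolding Mn_mnorm
proof (rule cSup_least)
  have z: "l2 m (\<lambda>_. 0::complex^'n) \<le> 1" by (simp add: L2_set_def)
  show "{l2 m (\<lambda>i. \<Sum>j<m. A i j *v v j) | v. l2 m v \<le> 1} \<noteq> {}"
    by (intro ex_in_conv[THEN iffD1] exI CollectI) (rule conjI[OF refl z])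
qed (use assms in auto)

lemma Mn_mnorm_nonneg:
  fixes A :: "nat \<Rightarrow> nat \<Rightarrow> complex^'n^'n"
  shows "0 \<le> mnorm Mn m A"
proof (cases "m = 0")
  case True
  have "{l2 m (\<lambda>i. \<Sum>j<m. A i j *v v j) | v. l2 m v \<le> 1} = {0}"
    using True by (auto simp: L2_set_def)
  then show ?thesis unfolding Mn_mnorm by simp
next
  case False
  define v :: "nat \<Rightarrow> complex^'n" where "v = (\<lambda>j. if j = 0 then axis undefined 1 else 0)"
  have "(\<Sum>j<m. (norm (v j))\<^sup>2) = (\<Sum>j\<in>{0}. (norm (v j))\<^sup>2)"
    using False by (intro sum.mono_neutral_right) (auto simp: v_def)
  then have "l2 m v = 1" by (simp add: L2_set_def v_def)
  then show ?thesis
    using order_trans[OF L2_set_nonneg Mn_apply_le[where m = m and A = A and v = v]] by simp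
qed

lemma entry_le_Mn_mnorm:
  fixes A :: "nat \<Rightarrow> nat \<Rightarrow> complex^'n^'n"
  assumes "i < m" "j < m"
  shows "cmod (A i j $ r $ s) \<le> mnorm Mn m A"
proof -
  define v :: "nat \<Rightarrow> complex^'n" where "v = (\<lambda>k. if k = j then axis s 1 else 0)"
  have "(\<Sum>k<m. (norm (v k))\<^sup>2) = (\<Sum>k\<in>{j}. (norm (v k))\<^sup>2)"
    using assms by (intro sum.mono_neutral_right) (auto simp: v_def)
  then have l: "l2 m v = 1" by (simp add: L2_set_def v_def)
  have "(\<Sum>k<m. A i k *v v k) = (\<Sum>k\<in>{j}. A i k *v v k)"
    using assms by (intro sum.mono_neutral_right) (auto simp: v_def)
  also have "\<dots> = A i j *v axis s 1" by (simp add: v_def)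
  finally have eq: "(\<Sum>k<m. A i k *v v k) = A i j *v axis s 1" .
  have "(\<Sum>k<m. A i k *v v k) $ r = A i j $ r $ s"
    unfolding eq
    by (simp add: matrix_vector_mult_def axis_def if_distrib[of "\<lambda>x. _ * x"] cong: if_cong)
  then have "cmod (A i j $ r $ s) \<le> norm (\<Sum>k<m. A i k *v v k)"
    by (metis Finite_Cartesian_Product.norm_nth_le)
  also have "\<dots> \<le> l2 m (\<lambda>i. \<Sum>j<m. A i j *v v j)"
    using assms norm_le_l2[of i m "\<lambda>i. \<Sum>k<m. A i k *v v k"] by simp
  also have "\<dots> \<le> mnorm Mn m A" using Mn_apply_le[where m = m and A = A and v = v] l by simp
  finally show ?thesis .
qed

text \<open>
  Together with the preceding lemma this makes the matrix norms over \<open>M\<^sub>n\<close> comparable with the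
  sizes of the entries, so that convergence and completeness can be checked entrywise.
\<close>
lemma Mn_mnorm_le_entries:
  fixes A :: "nat \<Rightarrow> nat \<Rightarrow> complex^'n^'n"
  shows "mnorm Mn m A \<le> (\<Sum>i<m. \<Sum>j<m. \<Sum>r\<in>UNIV. \<Sum>s\<in>UNIV. cmod (A i j $ r $ s))"
proof (rule Mn_mnorm_leI)
  fix v :: "nat \<Rightarrow> complex^'n" assume v: "l2 m v \<le> 1"
  have "l2 m (\<lambda>i. \<Sum>j<m. A i j *v v j) \<le> (\<Sum>i<m. norm (\<Sum>j<m. A i j *v v j))"
    by (rule L2_set_le_sum) simp
  also have "\<dots> \<le> (\<Sum>i<m. \<Sum>j<m. (\<Sum>r\<in>UNIV. \<Sum>s\<in>UNIV. cmod (A i j $ r $ s)) * 1)"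
    by (intro sum_mono order_trans[OF norm_sum] order_trans[OF norm_matrix_vector_le_entries])
       (auto intro!: mult_left_le sum_nonneg order_trans[OF norm_le_l2 v])
  finally show "l2 m (\<lambda>i. \<Sum>j<m. A i j *v v j)
      \<le> (\<Sum>i<m. \<Sum>j<m. \<Sum>r\<in>UNIV. \<Sum>s\<in>UNIV. cmod (A i j $ r $ s))" by simp
qed

text \<open>
  A scalar matrix acts on tuples of vectors separately in each coordinate, and the squares of the
  coordinate estimates add up.
\<close>
lemma scalar_mat_apply_vec_le:
  fixes v :: "nat \<Rightarrow> complex^'n"
  shows "l2 p (\<lambda>i. \<Sum>j<q. a i j *s v j) \<le> scalar_mat_norm p q a * l2 q v"
proof -
  let ?N = "scalar_mat_norm p q a"
  have norm2: "(norm x)\<^sup>2 = (\<Sum>r\<in>UNIV. (cmod (x $ r))\<^sup>2)" for x :: "complex^'n"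
    by (simp add: norm_vec_def L2_set_def sum_nonneg)
  have "(\<Sum>i<p. (norm (\<Sum>j<q. a i j *s v j))\<^sup>2)
      = (\<Sum>r\<in>UNIV. \<Sum>i<p. (cmod (\<Sum>j<q. a i j * v j $ r))\<^sup>2)"
    unfolding norm2 by (subst sum.swap) (simp add: vector_scalar_mult_def)
  also have "\<dots> = (\<Sum>r\<in>UNIV. (l2 p (\<lambda>i. \<Sum>j<q. a i j * v j $ r))\<^sup>2)"
    by (simp only: l2_square)
  also have "\<dots> \<le> (\<Sum>r\<in>UNIV. (?N * l2 q (\<lambda>j. v j $ r))\<^sup>2)"
    by (intro sum_mono power_mono scalar_mat_apply_le) simp
  also have "\<dots> = ?N\<^sup>2 * (\<Sum>r\<in>UNIV. (l2 q (\<lambda>j. v j $ r))\<^sup>2)"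
    by (simp add: power_mult_distrib sum_distrib_left)
  also have "(\<Sum>r\<in>UNIV. (l2 q (\<lambda>j. v j $ r))\<^sup>2) = (l2 q v)\<^sup>2"
    unfolding l2_square norm2 by (rule sum.swap)
  finally have "(\<Sum>i<p. (norm (\<Sum>j<q. a i j *s v j))\<^sup>2) \<le> (?N * l2 q v)\<^sup>2"
    by (simp add: power_mult_distrib)
  then show ?thesis by (subst l2_le_iff) (auto simp: scalar_mat_norm_nonneg)
qed

section \<open>Matrix-normed spaces\<close>

text \<open>
  Matrix units are contractions; by the axiom on \<^const>\<open>mat_sandwich\<close>, putting an element at
  one place of a zero matrix therefore does not increase its norm.
\<close>
lemma scalar_mat_norm_unit_le:
  "scalar_mat_norm p q (\<lambda>i j. if i = i0 \<and> j = j0 then 1 else 0) \<le> 1"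
proof (rule scalar_mat_norm_leI)
  fix v :: "nat \<Rightarrow> complex" assume v: "l2 q v \<le> 1"
  have eq: "(\<Sum>j<q. (if i = i0 \<and> j = j0 then 1 else 0) * v j)
      = (if i = i0 then (if j0 < q then v j0 else 0) else 0)" for i
  proof -
    have "(\<Sum>j<q. (if i = i0 \<and> j = j0 then 1 else 0) * v j)
        = (\<Sum>j<q. if j = j0 then (if i = i0 then v j else 0) else 0)"
      by (rule sum.cong) auto
    then show ?thesis by (simp add: sum.delta)
  qed
  have "l2 p (\<lambda>i. \<Sum>j<q. (if i = i0 \<and> j = j0 then 1 else 0) * v j)
      \<le> (\<Sum>i<p. if i = i0 then norm (if j0 < q then v j0 else 0) else 0)"
    unfolding eq by (rule order_trans[OF L2_set_le_sum], simp, rule sum_mono, simp)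
  also have "\<dots> \<le> norm (if j0 < q then v j0 else 0)"
    by (simp add: sum.delta)
  also have "\<dots> \<le> 1" using order_trans[OF norm_le_l2 v] by auto
  finally show "l2 p (\<lambda>i. \<Sum>j<q. (if i = i0 \<and> j = j0 then 1 else 0) * v j) \<le> 1" .
qed

text \<open>
  These are the axioms of an operator space except completeness.  They already imply that
  \<^const>\<open>vdist\<close> is a metric, which has to be known before completeness can be unfolded.
  A linear subspace with the inherited matrix norms is also of this kind.
\<close>
locale matrix_normed_space =
  fixes V :: "'a::ab_group_add op_space"
  assumes vector_space_scl: "vector_space (scl V)"
    and subspace_carrier: "module.subspace (scl V) (space_carrier V)"
    and mnorm_triangle: "\<And>m x y. \<lbrakk>0 < m; x \<in> matrices_over V m; y \<in> matrices_over V m\<rbrakk>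
      \<Longrightarrow> mnorm V m (\<lambda>i j. x i j + y i j) \<le> mnorm V m x + mnorm V m y"
    and mnorm_scl: "\<And>m c x. \<lbrakk>0 < m; x \<in> matrices_over V m\<rbrakk>
      \<Longrightarrow> mnorm V m (\<lambda>i j. scl V c (x i j)) = cmod c * mnorm V m x"
    and mnorm_eq_0_iff: "\<And>m x. \<lbrakk>0 < m; x \<in> matrices_over V m\<rbrakk>
      \<Longrightarrow> mnorm V m x = 0 \<longleftrightarrow> (\<forall>i<m. \<forall>j<m. x i j = 0)"
    and mnorm_dsum: "\<And>p q x y. \<lbrakk>0 < p; 0 < q; x \<in> matrices_over V p; y \<in> matrices_over V q\<rbrakk>
      \<Longrightarrow> mnorm V (p + q) (mat_dsum p x y) = max (mnorm V p x) (mnorm V q y)"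
    and mnorm_sandwich: "\<And>p q a x b. \<lbrakk>0 < p; 0 < q; x \<in> matrices_over V p\<rbrakk>
      \<Longrightarrow> mnorm V q (mat_sandwich V p a x b)
            \<le> scalar_mat_norm q p a * mnorm V p x * scalar_mat_norm p q b"
begin

sublocale vs: vector_space "scl V" by (rule vector_space_scl)

lemma carrier_0: "0 \<in> space_carrier V"
  using subspace_carrier by (rule vs.subspace_0)
lemma carrier_add: "x \<in> space_carrier V \<Longrightarrow> y \<in> space_carrier V \<Longrightarrow> x + y \<in> space_carrier V"
  using subspace_carrier by (rule vs.subspace_add)
lemma carrier_diff: "x \<in> space_carrier V \<Longrightarrow> y \<in> space_carrier V \<Longrightarrow> x - y \<in> space_carrier V"
  using subspace_carrier by (rule vs.subspace_diff)
lemma carrier_scl: "x \<in> space_carrier V \<Longrightarrow> scl V c x \<in> space_carrier V"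
  using subspace_carrier by (rule vs.subspace_scale)
lemma carrier_sum: "(\<And>i. i \<in> I \<Longrightarrow> f i \<in> space_carrier V) \<Longrightarrow> sum f I \<in> space_carrier V"
  using subspace_carrier by (rule vs.subspace_sum)

lemma matrices_over_0: "(\<lambda>i j. 0) \<in> matrices_over V m"
  by (simp add: matrices_over_def carrier_0)

lemma matrices_over_sandwich:
  "x \<in> matrices_over V m \<Longrightarrow> mat_sandwich V m a x b \<in> matrices_over V q"
  by (auto simp: matrices_over_def mat_sandwich_def intro!: carrier_sum carrier_scl)

lemma matrices_over_dsum:
  "x \<in> matrices_over V p \<Longrightarrow> y \<in> matrices_over V q \<Longrightarrow> mat_dsum p x y \<in> matrices_over V (p + q)"
  by (auto simp: matrices_over_def mat_dsum_def carrier_0)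

lemma mnorm_0: "0 < m \<Longrightarrow> mnorm V m (\<lambda>i j. 0) = 0"
  by (simp add: mnorm_eq_0_iff matrices_over_0)

lemma mnorm_minus:
  assumes "0 < m" "x \<in> matrices_over V m"
  shows "mnorm V m (\<lambda>i j. - x i j) = mnorm V m x"
  using mnorm_scl[OF assms, of "-1"] by simp

lemma mnorm_nonneg:
  assumes "0 < m" "x \<in> matrices_over V m"
  shows "0 \<le> mnorm V m x"
proof -
  have "(\<lambda>i j. - x i j) \<in> matrices_over V m"
    using assms(2) subspace_carrier by (auto simp: matrices_over_def intro: vs.subspace_neg)
  from mnorm_triangle[OF assms this] show ?thesis
    using assms by (simp add: mnorm_0 mnorm_minus)
qed

text \<open>
  Matrices that agree on the relevant block differ by a matrix of norm 0.
\<close>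
lemma mnorm_cong:
  assumes "0 < m" "x \<in> matrices_over V m" and eq: "\<And>i j. i < m \<Longrightarrow> j < m \<Longrightarrow> x i j = y i j"
  shows "mnorm V m x = mnorm V m y"
proof -
  have le: "mnorm V m x \<le> mnorm V m y"
    if "x \<in> matrices_over V m" "y \<in> matrices_over V m"
      and eq: "\<And>i j. i < m \<Longrightarrow> j < m \<Longrightarrow> x i j = y i j" for x y
  proof -
    have D: "(\<lambda>i j. x i j - y i j) \<in> matrices_over V m"
      using that(1,2) by (simp add: matrices_over_def carrier_diff)
    have "mnorm V m (\<lambda>i j. x i j - y i j) = 0"
      using mnorm_eq_0_iff[OF assms(1) D] eq by simp
    then show ?thesis
      using mnorm_triangle[OF assms(1) that(2) D] by simp
  qed
  have "y \<in> matrices_over V m" using assms(2) eq by (auto simp: matrices_over_def)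
  then show ?thesis using le[of x y] le[of y x] assms(2) eq by (simp add: order.antisym)
qed

lemma mnorm_sum_le:
  assumes "0 < m" "finite I" "\<And>k. k \<in> I \<Longrightarrow> x k \<in> matrices_over V m"
  shows "mnorm V m (\<lambda>i j. \<Sum>k\<in>I. x k i j) \<le> (\<Sum>k\<in>I. mnorm V m (x k))"
  using assms(2,3)
proof (induction I)
  case empty
  then show ?case using assms(1) by (simp add: mnorm_0)
next
  case (insert k I)
  have "(\<lambda>i j. \<Sum>k\<in>I. x k i j) \<in> matrices_over V m"
    using insert.prems by (auto simp: matrices_over_def intro!: carrier_sum)
  from mnorm_triangle[OF assms(1) _ this, of "x k"] show ?case
    using insert by simp
qed

lemma mnorm_single_le:
  assumes "0 < m" "v \<in> space_carrier V"
  shows "mnorm V m (\<lambda>i j. if i = i0 \<and> j = j0 then v else 0) \<le> vnorm V v"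
proof -
  let ?a = "\<lambda>k l. if k = i0 \<and> l = 0 then 1 else (0::complex)"
  let ?b = "\<lambda>k l. if k = 0 \<and> l = j0 then 1 else (0::complex)"
  have M: "(\<lambda>_ _. v) \<in> matrices_over V 1" using assms by (simp add: matrices_over_def)
  have eq: "mat_sandwich V 1 ?a (\<lambda>_ _. v) ?b = (\<lambda>i j. if i = i0 \<and> j = j0 then v else 0)"
    by (auto simp: mat_sandwich_def fun_eq_iff)
  have "mnorm V m (mat_sandwich V 1 ?a (\<lambda>_ _. v) ?b)
      \<le> scalar_mat_norm m 1 ?a * vnorm V v * scalar_mat_norm 1 m ?b"
    unfolding vnorm_def using assms M by (intro mnorm_sandwich) auto
  also have "\<dots> \<le> 1 * vnorm V v * 1"
    unfolding vnorm_def
    by (intro mult_mono scalar_mat_norm_unit_le scalar_mat_norm_nonneg order_refl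
        mult_nonneg_nonneg mnorm_nonneg M) auto
  finally show ?thesis unfolding eq by simp
qed

lemma mnorm_le_sum_vnorm:
  assumes "0 < m" "x \<in> matrices_over V m"
  shows "mnorm V m x \<le> (\<Sum>k<m. \<Sum>l<m. vnorm V (x k l))"
proof -
  let ?E = "\<lambda>k l i j. if i = k \<and> j = l then x k l else 0"
  have E: "?E k l \<in> matrices_over V m" if "k < m" "l < m" for k l
    using assms that by (auto simp: matrices_over_def carrier_0)
  have eq: "(\<Sum>k<m. \<Sum>l<m. ?E k l i j) = x i j" if "i < m" "j < m" for i j
  proof -
    have "(\<Sum>k<m. \<Sum>l<m. ?E k l i j) = (\<Sum>k<m. if k = i then \<Sum>l<m. if l = j then x k l else 0 else 0)"
      by (intro sum.cong refl) (auto intro!: sum.cong)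
    then show ?thesis using that by (simp add: sum.delta)
  qed
  have "mnorm V m x = mnorm V m (\<lambda>i j. \<Sum>k<m. \<Sum>l<m. ?E k l i j)"
    using assms by (intro mnorm_cong) (auto simp only: eq)
  also have "\<dots> \<le> (\<Sum>k<m. mnorm V m (\<lambda>i j. \<Sum>l<m. ?E k l i j))"
    using E by (intro mnorm_sum_le assms) (auto simp: matrices_over_def intro!: carrier_sum carrier_0)
  also have "\<dots> \<le> (\<Sum>k<m. \<Sum>l<m. mnorm V m (?E k l))"
    using E by (intro sum_mono mnorm_sum_le assms) auto
  also have "\<dots> \<le> (\<Sum>k<m. \<Sum>l<m. vnorm V (x k l))"
    using assms by (intro sum_mono mnorm_single_le) (auto simp: matrices_over_def)
  finally show ?thesis .
qed

lemma vnorm_nonneg: "v \<in> space_carrier V \<Longrightarrow> 0 \<le> vnorm V v"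
  unfolding vnorm_def by (rule mnorm_nonneg) (auto simp: matrices_over_def)

lemma vnorm_0: "vnorm V 0 = 0"
  unfolding vnorm_def by (rule mnorm_0) simp

lemma vnorm_eq_0_iff: "v \<in> space_carrier V \<Longrightarrow> vnorm V v = 0 \<longleftrightarrow> v = 0"
  unfolding vnorm_def by (subst mnorm_eq_0_iff) (auto simp: matrices_over_def)

lemma vnorm_triangle:
  "v \<in> space_carrier V \<Longrightarrow> w \<in> space_carrier V \<Longrightarrow> vnorm V (v + w) \<le> vnorm V v + vnorm V w"
  unfolding vnorm_def by (rule mnorm_triangle) (auto simp: matrices_over_def)

lemma vnorm_scl: "v \<in> space_carrier V \<Longrightarrow> vnorm V (scl V c v) = cmod c * vnorm V v"
  unfolding vnorm_def by (rule mnorm_scl) (auto simp: matrices_over_def)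

lemma vnorm_diff_commute:
  assumes "v \<in> space_carrier V" "w \<in> space_carrier V"
  shows "vnorm V (v - w) = vnorm V (w - v)"
  using vnorm_scl[of "v - w" "-1"] assms by (simp add: carrier_diff)

lemma vnorm_diff_triangle:
  assumes "u \<in> space_carrier V" "v \<in> space_carrier V" "w \<in> space_carrier V"
  shows "vnorm V (u - w) \<le> vnorm V (u - v) + vnorm V (v - w)"
  using vnorm_triangle[of "u - v" "v - w"] assms by (simp add: carrier_diff)

sublocale met: Metric_space "space_carrier V" "vdist V"
proof
  fix x y z
  show "0 \<le> vdist V x y" by (auto simp: vdist_def intro!: vnorm_nonneg carrier_diff)
  show "vdist V x y = vdist V y x" by (auto simp: vdist_def vnorm_diff_commute)
  assume *: "x \<in> space_carrier V" "y \<in> space_carrier V"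
  then show "(vdist V x y = 0) = (x = y)" by (simp add: vdist_def vnorm_eq_0_iff carrier_diff)
  assume "z \<in> space_carrier V"
  then show "vdist V x z \<le> vdist V x y + vdist V y z"
    using * by (simp add: vdist_def vnorm_diff_triangle)
qed

text \<open>
  This lemma and the next translate between the abstract metric notions and the norm, so that
  completeness proofs can be carried out with norms of differences.
\<close>
lemma mcompleteI:
  assumes "\<And>\<sigma>. \<lbrakk>\<And>n. \<sigma> n \<in> space_carrier V;
      \<And>e. e > 0 \<Longrightarrow> \<exists>N. \<forall>n\<ge>N. \<forall>k\<ge>N. vnorm V (\<sigma> n - \<sigma> k) < e\<rbrakk>
    \<Longrightarrow> \<exists>l\<in>space_carrier V. (\<lambda>n. vnorm V (\<sigma> n - l)) \<longlonglongrightarrow> 0"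
  shows "met.mcomplete"
  unfolding met.mcomplete_def
proof (intro allI impI)
  fix \<sigma> assume \<sigma>: "met.MCauchy \<sigma>"
  then have c: "\<sigma> n \<in> space_carrier V" for n by (auto simp: met.MCauchy_def)
  have "\<exists>l\<in>space_carrier V. (\<lambda>n. vnorm V (\<sigma> n - l)) \<longlonglongrightarrow> 0"
  proof (rule assms)
    fix e :: real assume "e > 0"
    then obtain N where "\<forall>n n'. N \<le> n \<longrightarrow> N \<le> n' \<longrightarrow> vdist V (\<sigma> n) (\<sigma> n') < e"
      using \<sigma> unfolding met.MCauchy_def by blast
    then show "\<exists>N. \<forall>n\<ge>N. \<forall>k\<ge>N. vnorm V (\<sigma> n - \<sigma> k) < e"
      using c by (auto simp: vdist_def)
  qed (rule c)
  then obtain l where l: "l \<in> space_carrier V" "(\<lambda>n. vnorm V (\<sigma> n - l)) \<longlonglongrightarrow> 0" by blast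
  then have "limitin met.mtopology \<sigma> l sequentially"
    unfolding met.limitin_metric_dist_null using c by (simp add: vdist_def)
  then show "\<exists>x. limitin met.mtopology \<sigma> x sequentially" ..
qed

lemma mcompleteD:
  assumes "met.mcomplete" and c: "\<And>n. \<sigma> n \<in> space_carrier V"
    and C: "\<And>e. e > 0 \<Longrightarrow> \<exists>N. \<forall>n\<ge>N. \<forall>k\<ge>N. vnorm V (\<sigma> n - \<sigma> k) < e"
  shows "\<exists>l\<in>space_carrier V. (\<lambda>n. vnorm V (\<sigma> n - l)) \<longlonglongrightarrow> 0"
proof -
  have "met.MCauchy \<sigma>"
    unfolding met.MCauchy_def
  proof (intro conjI allI impI)
    show "range \<sigma> \<subseteq> space_carrier V" using c by auto
    fix e :: real assume "e > 0"
    then obtain N where "\<forall>n\<ge>N. \<forall>k\<ge>N. vnorm V (\<sigma> n - \<sigma> k) < e" using C by blast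
    then show "\<exists>N. \<forall>n n'. N \<le> n \<longrightarrow> N \<le> n' \<longrightarrow> vdist V (\<sigma> n) (\<sigma> n') < e"
      using c by (intro exI[of _ N]) (simp add: vdist_def)
  qed
  then obtain l where "limitin met.mtopology \<sigma> l sequentially"
    using assms(1) unfolding met.mcomplete_def by blast
  then have l: "l \<in> space_carrier V" "(\<lambda>n. vdist V (\<sigma> n) l) \<longlonglongrightarrow> 0"
    unfolding met.limitin_metric_dist_null by blast+
  have "(\<lambda>n. vdist V (\<sigma> n) l) = (\<lambda>n. vnorm V (\<sigma> n - l))"
    using c l(1) by (simp add: vdist_def)
  then show ?thesis using l by (intro bexI[of _ l]) simp_all
qed

end

lemma operator_space_iff:
  "operator_space V \<longleftrightarrow> matrix_normed_space V \<and> Metric_space.mcomplete (space_carrier V) (vdist V)"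
  unfolding operator_space_def matrix_normed_space_def by (simp only: conj_assoc)

section \<open>The operator space of n-by-n matrices\<close>

lemma l2_triangle: "l2 m (\<lambda>i. f i + g i) \<le> l2 m f + l2 m g"
  by (rule order_trans[OF L2_set_mono L2_set_triangle_ineq]) (auto intro: norm_triangle_ineq)

lemma sum_lessThan_add:
  fixes f :: "nat \<Rightarrow> 'a::comm_monoid_add"
  shows "(\<Sum>i<p + q. f i) = (\<Sum>i<p. f i) + (\<Sum>i<q. f (p + i))"
  by (induction q) (simp_all add: add.assoc)

lemma l2_square_add: "(l2 (p + q) v)\<^sup>2 = (l2 p v)\<^sup>2 + (l2 q (\<lambda>i. v (p + i)))\<^sup>2"
  unfolding l2_square by (rule sum_lessThan_add)

lemma Mn_mnorm_le_factor:
  fixes A :: "nat \<Rightarrow> nat \<Rightarrow> complex^'n^'n"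
  assumes "0 \<le> B" "\<And>v. l2 m (\<lambda>i. \<Sum>j<m. A i j *v v j) \<le> B * l2 m v"
  shows "mnorm Mn m A \<le> B"
proof (rule Mn_mnorm_leI)
  fix v :: "nat \<Rightarrow> complex^'n" assume "l2 m v \<le> 1"
  then have "B * l2 m v \<le> B" using assms(1) by (intro mult_left_le)
  then show "l2 m (\<lambda>i. \<Sum>j<m. A i j *v v j) \<le> B" using assms(2)[of v] by linarith
qed

lemma norm_vector_smult: "norm (c *s x) = cmod c * norm (x :: complex^'n)"
  by (simp add: norm_vec_def norm_mult L2_set_right_distrib)

lemma scl_Mn_mult_vec: "scl Mn c A *v x = c *s (A *v x)"
  by (simp add: vec_eq_iff matrix_vector_mult_def sum_distrib_left mult.assoc)

lemma mat_mult_vec_smult: "A *v (c *s x) = c *s (A *v (x :: complex^'n))"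
  by (simp add: vec_eq_iff matrix_vector_mult_def sum_distrib_left mult_ac)

lemma mat_mult_vec_sum: "A *v (\<Sum>i\<in>I. f i) = (\<Sum>i\<in>I. A *v (f i :: complex^'n))"
  by (induction I rule: infinite_finite_induct) (auto simp: matrix_vector_right_distrib)

lemma mat_sum_mult_vec: "(\<Sum>i\<in>I. F i) *v x = (\<Sum>i\<in>I. F i *v (x :: complex^'n))"
  by (induction I rule: infinite_finite_induct) (auto simp: matrix_vector_mult_add_rdistrib)

text \<open>
  On columns of vectors, \<open>a x b\<close> acts as \<open>b\<close>, then \<open>x\<close>, then \<open>a\<close>; the norm estimate for
  \<open>a x b\<close> is the composition of three estimates.
\<close>
lemma mat_sandwich_Mn_apply:
  fixes v :: "nat \<Rightarrow> complex^'n"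
  shows "(\<Sum>j<q. mat_sandwich Mn p a x b i j *v v j)
    = (\<Sum>k<p. a i k *s (\<Sum>l<p. x k l *v (\<Sum>j<q. b l j *s v j)))"
proof -
  have "(\<Sum>j<q. mat_sandwich Mn p a x b i j *v v j)
      = (\<Sum>j<q. \<Sum>k<p. \<Sum>l<p. (a i k * b l j) *s (x k l *v v j))"
    by (simp add: mat_sandwich_def mat_sum_mult_vec scl_Mn_mult_vec)
  also have "\<dots> = (\<Sum>k<p. \<Sum>l<p. \<Sum>j<q. (a i k * b l j) *s (x k l *v v j))"
    by (rule trans[OF sum.swap], rule sum.cong[OF refl], rule sum.swap)
  also have "\<dots> = (\<Sum>k<p. a i k *s (\<Sum>l<p. x k l *v (\<Sum>j<q. b l j *s v j)))"
    by (simp add: mat_mult_vec_sum mat_mult_vec_smult vec.scale_sum_right)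
  finally show ?thesis .
qed

lemma mat_dsum_Mn_apply:
  fixes v :: "nat \<Rightarrow> complex^'n"
  shows "i < p \<Longrightarrow> (\<Sum>j<p + q. mat_dsum p x y i j *v v j) = (\<Sum>j<p. x i j *v v j)"
    and "(\<Sum>j<p + q. mat_dsum p x y (p + i) j *v v j) = (\<Sum>j<q. y i j *v v (p + j))"
  unfolding sum_lessThan_add by (simp_all add: mat_dsum_def)

text \<open>
  The two diagonal blocks act on orthogonal summands.
\<close>
lemma Mn_dsum_le:
  fixes x y :: "nat \<Rightarrow> nat \<Rightarrow> complex^'n^'n"
  shows "mnorm Mn (p + q) (mat_dsum p x y) \<le> max (mnorm Mn p x) (mnorm Mn q y)" (is "_ \<le> ?M")
proof (rule Mn_mnorm_le_factor)
  show M0: "0 \<le> ?M" using Mn_mnorm_nonneg[of p x] by (simp add: max.coboundedI1)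
  fix v :: "nat \<Rightarrow> complex^'n"
  let ?w = "\<lambda>i. \<Sum>j<p + q. mat_dsum p x y i j *v v j"
  have 1: "l2 p ?w \<le> ?M * l2 p v"
  proof -
    have "l2 p ?w = l2 p (\<lambda>i. \<Sum>j<p. x i j *v v j)"
      by (intro L2_set_cong refl) (simp add: mat_dsum_Mn_apply)
    also have "\<dots> \<le> mnorm Mn p x * l2 p v" by (rule Mn_apply_le)
    also have "\<dots> \<le> ?M * l2 p v" by (intro mult_right_mono) auto
    finally show ?thesis .
  qed
  have 2: "l2 q (\<lambda>i. ?w (p + i)) \<le> ?M * l2 q (\<lambda>j. v (p + j))"
  proof -
    have "l2 q (\<lambda>i. ?w (p + i)) = l2 q (\<lambda>i. \<Sum>j<q. y i j *v v (p + j))"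
      by (intro L2_set_cong refl) (simp add: mat_dsum_Mn_apply)
    also have "\<dots> \<le> mnorm Mn q y * l2 q (\<lambda>j. v (p + j))" by (rule Mn_apply_le)
    also have "\<dots> \<le> ?M * l2 q (\<lambda>j. v (p + j))" by (intro mult_right_mono) auto
    finally show ?thesis .
  qed
  have "(l2 (p + q) ?w)\<^sup>2 \<le> (?M * l2 p v)\<^sup>2 + (?M * l2 q (\<lambda>j. v (p + j)))\<^sup>2"
    unfolding l2_square_add[where v = ?w] by (intro add_mono power_mono 1 2) auto
  also have "\<dots> = (?M * l2 (p + q) v)\<^sup>2"
    by (simp add: power_mult_distrib l2_square_add[where v = v] distrib_left)
  finally show "l2 (p + q) ?w \<le> ?M * l2 (p + q) v"
    by (rule power2_le_imp_le) (simp add: M0)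
qed

text \<open>
  Vectors supported in one of the two summands only see the corresponding block.
\<close>
lemma Mn_dsum_ge:
  fixes x y :: "nat \<Rightarrow> nat \<Rightarrow> complex^'n^'n"
  shows "mnorm Mn p x \<le> mnorm Mn (p + q) (mat_dsum p x y)"
    and "mnorm Mn q y \<le> mnorm Mn (p + q) (mat_dsum p x y)"
proof -
  let ?M = "mnorm Mn (p + q) (mat_dsum p x y)"
  show "mnorm Mn p x \<le> ?M"
  proof (rule Mn_mnorm_le_factor)
    fix v :: "nat \<Rightarrow> complex^'n"
    let ?v = "\<lambda>j. if j < p then v j else 0"
    let ?w = "\<lambda>i. \<Sum>j<p + q. mat_dsum p x y i j *v ?v j"
    have "l2 p (\<lambda>i. \<Sum>j<p. x i j *v v j) = l2 p ?w"
      by (intro L2_set_cong refl) (simp add: mat_dsum_Mn_apply)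
    also have "\<dots> \<le> l2 (p + q) ?w"
      by (rule power2_le_imp_le) (simp_all add: l2_square_add[where v = ?w])
    also have "\<dots> \<le> ?M * l2 (p + q) ?v" by (rule Mn_apply_le)
    also have "l2 (p + q) ?v = l2 p v"
      unfolding L2_set_def sum_lessThan_add by simp
    finally show "l2 p (\<lambda>i. \<Sum>j<p. x i j *v v j) \<le> ?M * l2 p v" .
  qed (rule Mn_mnorm_nonneg)
  show "mnorm Mn q y \<le> ?M"
  proof (rule Mn_mnorm_le_factor)
    fix v :: "nat \<Rightarrow> complex^'n"
    let ?v = "\<lambda>j. if j < p then 0 else v (j - p)"
    let ?w = "\<lambda>i. \<Sum>j<p + q. mat_dsum p x y i j *v ?v j"
    have "l2 q (\<lambda>i. \<Sum>j<q. y i j *v v j) = l2 q (\<lambda>i. ?w (p + i))"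
      by (intro L2_set_cong refl) (simp add: mat_dsum_Mn_apply)
    also have "\<dots> \<le> l2 (p + q) ?w"
      by (rule power2_le_imp_le) (simp_all add: l2_square_add[where v = ?w])
    also have "\<dots> \<le> ?M * l2 (p + q) ?v" by (rule Mn_apply_le)
    also have "l2 (p + q) ?v = l2 q v"
      unfolding L2_set_def sum_lessThan_add by simp
    finally show "l2 q (\<lambda>i. \<Sum>j<q. y i j *v v j) \<le> ?M * l2 q v" .
  qed (rule Mn_mnorm_nonneg)
qed

lemma Mn_sandwich_le:
  fixes x :: "nat \<Rightarrow> nat \<Rightarrow> complex^'n^'n"
  shows "mnorm Mn q (mat_sandwich Mn p a x b)
    \<le> scalar_mat_norm q p a * mnorm Mn p x * scalar_mat_norm p q b"
proof (rule Mn_mnorm_le_factor)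
  show "0 \<le> scalar_mat_norm q p a * mnorm Mn p x * scalar_mat_norm p q b"
    by (simp add: scalar_mat_norm_nonneg Mn_mnorm_nonneg)
  fix v :: "nat \<Rightarrow> complex^'n"
  let ?bv = "\<lambda>l. \<Sum>j<q. b l j *s v j"
  let ?xbv = "\<lambda>k. \<Sum>l<p. x k l *v ?bv l"
  have "l2 q (\<lambda>i. \<Sum>j<q. mat_sandwich Mn p a x b i j *v v j) = l2 q (\<lambda>i. \<Sum>k<p. a i k *s ?xbv k)"
    by (simp only: mat_sandwich_Mn_apply)
  also have "\<dots> \<le> scalar_mat_norm q p a * l2 p ?xbv"
    by (rule scalar_mat_apply_vec_le)
  also have "\<dots> \<le> scalar_mat_norm q p a * (mnorm Mn p x * l2 p ?bv)"
    by (intro mult_left_mono Mn_apply_le scalar_mat_norm_nonneg)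
  also have "\<dots> \<le> scalar_mat_norm q p a * (mnorm Mn p x * (scalar_mat_norm p q b * l2 q v))"
    by (intro mult_left_mono scalar_mat_apply_vec_le scalar_mat_norm_nonneg Mn_mnorm_nonneg)
  finally show "l2 q (\<lambda>i. \<Sum>j<q. mat_sandwich Mn p a x b i j *v v j)
      \<le> scalar_mat_norm q p a * mnorm Mn p x * scalar_mat_norm p q b * l2 q v"
    by (simp add: mult.assoc)
qed

lemma Mn_scl_le:
  fixes x :: "nat \<Rightarrow> nat \<Rightarrow> complex^'n^'n"
  shows "mnorm Mn m (\<lambda>i j. scl Mn c (x i j)) \<le> cmod c * mnorm Mn m x"
proof (rule Mn_mnorm_le_factor)
  fix v :: "nat \<Rightarrow> complex^'n"
  have "l2 m (\<lambda>i. \<Sum>j<m. scl Mn c (x i j) *v v j) = cmod c * l2 m (\<lambda>i. \<Sum>j<m. x i j *v v j)"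
    by (simp add: scl_Mn_mult_vec norm_vector_smult L2_set_right_distrib flip: vec.scale_sum_right)
  also have "\<dots> \<le> cmod c * (mnorm Mn m x * l2 m v)"
    by (intro mult_left_mono Mn_apply_le) simp
  finally show "l2 m (\<lambda>i. \<Sum>j<m. scl Mn c (x i j) *v v j) \<le> cmod c * mnorm Mn m x * l2 m v"
    by (simp add: mult.assoc)
qed (simp add: Mn_mnorm_nonneg)

lemma matrix_normed_space_Mn: "matrix_normed_space (Mn :: (complex^'n^'n) op_space)"
proof (rule matrix_normed_space.intro)
  show vs: "vector_space (scl (Mn :: (complex^'n^'n) op_space))"
    by unfold_locales (simp_all add: vec_eq_iff distrib_left distrib_right)
  then interpret v: vector_space "scl (Mn :: (complex^'n^'n) op_space)" .
  show "module.subspace (scl (Mn :: (complex^'n^'n) op_space)) (space_carrier (Mn :: (complex^'n^'n) op_space))"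
    by simp
  fix m p q :: nat and x y :: "nat \<Rightarrow> nat \<Rightarrow> complex^'n^'n" and a b :: "nat \<Rightarrow> nat \<Rightarrow> complex"
    and c :: complex
  show "mnorm Mn m (\<lambda>i j. x i j + y i j) \<le> mnorm Mn m x + mnorm Mn m y"
  proof (rule Mn_mnorm_le_factor)
    fix v :: "nat \<Rightarrow> complex^'n"
    have "l2 m (\<lambda>i. \<Sum>j<m. (x i j + y i j) *v v j)
        = l2 m (\<lambda>i. (\<Sum>j<m. x i j *v v j) + (\<Sum>j<m. y i j *v v j))"
      by (simp add: matrix_vector_mult_add_rdistrib sum.distrib)
    also have "\<dots> \<le> l2 m (\<lambda>i. \<Sum>j<m. x i j *v v j) + l2 m (\<lambda>i. \<Sum>j<m. y i j *v v j)"
      by (rule l2_triangle)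
    also have "\<dots> \<le> mnorm Mn m x * l2 m v + mnorm Mn m y * l2 m v"
      by (intro add_mono Mn_apply_le)
    finally show "l2 m (\<lambda>i. \<Sum>j<m. (x i j + y i j) *v v j) \<le> (mnorm Mn m x + mnorm Mn m y) * l2 m v"
      by (simp add: distrib_right)
  qed (simp add: Mn_mnorm_nonneg)
  have zero: "mnorm Mn m x = 0 \<longleftrightarrow> (\<forall>i<m. \<forall>j<m. x i j = 0)" for x :: "nat \<Rightarrow> nat \<Rightarrow> complex^'n^'n"
  proof
    assume *: "mnorm Mn m x = 0"
    have "x i j $ r $ s = 0" if "i < m" "j < m" for i j r s
      using entry_le_Mn_mnorm[OF that, of x r s] * by simp
    then show "\<forall>i<m. \<forall>j<m. x i j = 0" by (simp add: vec_eq_iff)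
  next
    assume "\<forall>i<m. \<forall>j<m. x i j = 0"
    then show "mnorm Mn m x = 0"
      using Mn_mnorm_le_entries[of m x] Mn_mnorm_nonneg[of m x] by simp
  qed
  then show "mnorm Mn m x = 0 \<longleftrightarrow> (\<forall>i<m. \<forall>j<m. x i j = 0)" .
  show "mnorm Mn m (\<lambda>i j. scl Mn c (x i j)) = cmod c * mnorm Mn m x"
  proof (cases "c = 0")
    case True
    then show ?thesis using zero[of "\<lambda>i j. 0"] by simp
  next
    case False
    have "mnorm Mn m x = mnorm Mn m (\<lambda>i j. scl Mn (1 / c) (scl Mn c (x i j)))"
      using False by (simp only: v.scale_scale) simp
    also have "\<dots> \<le> cmod (1 / c) * mnorm Mn m (\<lambda>i j. scl Mn c (x i j))"
      by (rule Mn_scl_le)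
    finally have "cmod c * mnorm Mn m x \<le> mnorm Mn m (\<lambda>i j. scl Mn c (x i j))"
      using False by (simp add: norm_divide field_simps)
    then show ?thesis using Mn_scl_le[of m c x] by simp
  qed
  show "mnorm Mn (p + q) (mat_dsum p x y) = max (mnorm Mn p x) (mnorm Mn q y)"
    using Mn_dsum_le[of p q x y] Mn_dsum_ge[of p x q y] Mn_dsum_ge(2)[of q y p x] by simp
  show "mnorm Mn q (mat_sandwich Mn p a x b)
      \<le> scalar_mat_norm q p a * mnorm Mn p x * scalar_mat_norm p q b"
    by (rule Mn_sandwich_le)
qed

lemma Mn_vnorm_tendsto_0_iff:
  fixes A :: "'i \<Rightarrow> complex^'n^'n"
  shows "((\<lambda>k. vnorm Mn (A k)) \<longlongrightarrow> 0) F \<longleftrightarrow> (\<forall>r s. ((\<lambda>k. A k $ r $ s) \<longlongrightarrow> 0) F)"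
proof (intro iffI allI)
  fix r s assume *: "((\<lambda>k. vnorm Mn (A k)) \<longlongrightarrow> 0) F"
  have "cmod (A k $ r $ s) \<le> vnorm Mn (A k)" for k
    unfolding vnorm_def by (rule entry_le_Mn_mnorm[where i = 0 and j = 0 and A = "\<lambda>_ _. A k"]) auto
  then show "((\<lambda>k. A k $ r $ s) \<longlongrightarrow> 0) F"
    by (intro Lim_null_comparison[OF _ *]) simp
next
  assume *: "\<forall>r s. ((\<lambda>k. A k $ r $ s) \<longlongrightarrow> 0) F"
  have le: "norm (vnorm Mn (A k)) \<le> (\<Sum>r\<in>UNIV. \<Sum>s\<in>UNIV. cmod (A k $ r $ s))" for k
    unfolding vnorm_def using Mn_mnorm_le_entries[of 1 "\<lambda>_ _. A k"] Mn_mnorm_nonneg[of 1 "\<lambda>_ _. A k"]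
    by simp
  have lim: "((\<lambda>k. \<Sum>r\<in>UNIV. \<Sum>s\<in>UNIV. cmod (A k $ r $ s)) \<longlongrightarrow> 0) F"
    using * by (intro tendsto_null_sum) (simp add: tendsto_norm_zero)
  show "((\<lambda>k. vnorm Mn (A k)) \<longlongrightarrow> 0) F"
    by (rule Lim_null_comparison[OF always_eventually[OF allI[OF le]] lim])
qed

theorem operator_space_Mn: "operator_space (Mn :: (complex^'n^'n) op_space)"
  unfolding operator_space_iff
proof
  show "matrix_normed_space (Mn :: (complex^'n^'n) op_space)" by (rule matrix_normed_space_Mn)
  then interpret matrix_normed_space "Mn :: (complex^'n^'n) op_space" .
  show "met.mcomplete"
  proof (rule mcompleteI)
    fix \<sigma> :: "nat \<Rightarrow> complex^'n^'n"
    assume C: "\<And>e. e > 0 \<Longrightarrow> \<exists>N. \<forall>n\<ge>N. \<forall>k\<ge>N. vnorm Mn (\<sigma> n - \<sigma> k) < e"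
    have "convergent (\<lambda>n. \<sigma> n $ r $ s)" for r s
    proof (rule Cauchy_convergent, rule metric_CauchyI)
      fix e :: real assume "e > 0"
      then obtain N where N: "\<forall>n\<ge>N. \<forall>k\<ge>N. vnorm Mn (\<sigma> n - \<sigma> k) < e" using C by blast
      have "dist (\<sigma> n $ r $ s) (\<sigma> k $ r $ s) < e" if "n \<ge> N" "k \<ge> N" for n k
      proof -
        have "dist (\<sigma> n $ r $ s) (\<sigma> k $ r $ s) \<le> vnorm Mn (\<sigma> n - \<sigma> k)"
          unfolding vnorm_def dist_norm
          using entry_le_Mn_mnorm[of 0 1 0 "\<lambda>_ _. \<sigma> n - \<sigma> k" r s] by simp
        also have "\<dots> < e" using N that by blast
        finally show ?thesis .
      qed
      then show "\<exists>N. \<forall>n\<ge>N. \<forall>k\<ge>N. dist (\<sigma> n $ r $ s) (\<sigma> k $ r $ s) < e" by blast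
    qed
    then obtain L where L: "\<And>r s. (\<lambda>n. \<sigma> n $ r $ s) \<longlonglongrightarrow> L r s"
      unfolding convergent_def by metis
    have "(\<lambda>n. vnorm Mn (\<sigma> n - (\<chi> r s. L r s))) \<longlonglongrightarrow> 0"
      unfolding Mn_vnorm_tendsto_0_iff using L by (simp add: LIM_zero)
    then show "\<exists>l\<in>space_carrier Mn. (\<lambda>n. vnorm Mn (\<sigma> n - l)) \<longlonglongrightarrow> 0" by auto
  qed
qed

section \<open>Null sequences in an operator space\<close>

lemma sum_fun_apply: "(\<Sum>i\<in>I. f i) k = (\<Sum>i\<in>I. f i k)"
  by (induction I rule: infinite_finite_induct) auto

lemma c0_simps [simp]:
  "space_carrier (c0_space V) = {f. (\<forall>k. f k \<in> space_carrier V) \<and> (\<lambda>k. vnorm V (f k)) \<longlonglongrightarrow> 0}"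
  "scl (c0_space V) c f k = scl V c (f k)"
  by (simp_all add: c0_space_def)

lemma c0_mnorm: "mnorm (c0_space V) m x = (SUP k. mnorm V m (\<lambda>i j. x i j k))"
  by (simp add: c0_space_def)

lemma c0_mnorm_leI:
  assumes "\<And>k. mnorm V m (\<lambda>i j. x i j k) \<le> B"
  shows "mnorm (c0_space V) m x \<le> B"
  unfolding c0_mnorm using assms by (intro cSUP_least) auto

lemma matrices_over_c0_coord:
  "x \<in> matrices_over (c0_space V) m \<Longrightarrow> (\<lambda>i j. x i j k) \<in> matrices_over V m"
  by (auto simp: matrices_over_def)

context matrix_normed_space
begin

text \<open>
  The supremum over the coordinates is finite, since the finitely many entries are null sequences
  and hence bounded.
\<close>
lemma mnorm_coord_le_c0:
  assumes "0 < m" "x \<in> matrices_over (c0_space V) m"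
  shows "mnorm V m (\<lambda>i j. x i j k) \<le> mnorm (c0_space V) m x"
proof -
  have "(\<lambda>k. \<Sum>i<m. \<Sum>j<m. vnorm V (x i j k)) \<longlonglongrightarrow> 0"
    using assms(2) by (intro tendsto_null_sum) (auto simp: matrices_over_def)
  then have "Bseq (\<lambda>k. \<Sum>i<m. \<Sum>j<m. vnorm V (x i j k))"
    by (intro convergent_imp_Bseq convergentI)
  then obtain K where K: "\<And>k. norm (\<Sum>i<m. \<Sum>j<m. vnorm V (x i j k)) \<le> K"
    unfolding Bseq_def by blast
  have "mnorm V m (\<lambda>i j. x i j k) \<le> K" for k
    using mnorm_le_sum_vnorm[OF assms(1) matrices_over_c0_coord[OF assms(2)], of k] K[of k] by simp
  then have "bdd_above (range (\<lambda>k. mnorm V m (\<lambda>i j. x i j k)))"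
    by (intro bdd_aboveI) auto
  then show ?thesis unfolding c0_mnorm by (intro cSUP_upper) auto
qed

lemma vector_space_c0: "vector_space (scl (c0_space V))"
  by unfold_locales
    (simp_all add: fun_eq_iff vs.scale_left_distrib vs.scale_right_distrib)

lemma subspace_c0: "module.subspace (scl (c0_space V)) (space_carrier (c0_space V))"
proof -
  interpret c0: vector_space "scl (c0_space V)" by (rule vector_space_c0)
  show ?thesis
  proof (rule c0.subspaceI)
    show "0 \<in> space_carrier (c0_space V)" by (simp add: carrier_0 vnorm_0)
  next
    fix f g assume f: "f \<in> space_carrier (c0_space V)" and g: "g \<in> space_carrier (c0_space V)"
    have *: "(\<lambda>k. vnorm V (f k) + vnorm V (g k)) \<longlonglongrightarrow> 0"
      using f g by (auto intro: tendsto_add_zero)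
    have "(\<lambda>k. vnorm V (f k + g k)) \<longlonglongrightarrow> 0"
      by (rule Lim_null_comparison[OF _ *])
         (use f g in \<open>auto intro!: always_eventually vnorm_triangle simp: vnorm_nonneg carrier_add\<close>)
    then show "f + g \<in> space_carrier (c0_space V)" using f g by (simp add: carrier_add)
  next
    fix c f assume f: "f \<in> space_carrier (c0_space V)"
    then show "scl (c0_space V) c f \<in> space_carrier (c0_space V)"
      by (auto simp: carrier_scl vnorm_scl intro: tendsto_mult_right_zero)
  qed
qed

lemma mat_sandwich_c0_coord:
  "mat_sandwich (c0_space V) p a x b i j k = mat_sandwich V p a (\<lambda>i j. x i j k) b i j"
  by (simp add: mat_sandwich_def sum_fun_apply)

lemma mat_dsum_coord:
  "mat_dsum p x y i j k = mat_dsum p (\<lambda>i j. x i j k) (\<lambda>i j. y i j k) i j"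
  by (simp add: mat_dsum_def)

lemma matrix_normed_space_c0: "matrix_normed_space (c0_space V)"
proof (rule matrix_normed_space.intro)
  show "vector_space (scl (c0_space V))" by (rule vector_space_c0)
  then interpret c0: vector_space "scl (c0_space V)" .
  show "module.subspace (scl (c0_space V)) (space_carrier (c0_space V))"
    by (rule subspace_c0)
  let ?Z = "c0_space V"
  fix m p q :: nat and x y :: "nat \<Rightarrow> nat \<Rightarrow> nat \<Rightarrow> 'a" and a b :: "nat \<Rightarrow> nat \<Rightarrow> complex"
    and c :: complex
  {
    assume m: "0 < m" and x: "x \<in> matrices_over ?Z m"
    note xk = matrices_over_c0_coord[OF x]
    have scx: "(\<lambda>i j. scl ?Z c (x i j)) \<in> matrices_over ?Z m"
      using x subspace_c0 c0.subspace_scale by (auto simp only: matrices_over_def)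
    {
      assume y: "y \<in> matrices_over ?Z m"
      show "mnorm ?Z m (\<lambda>i j. x i j + y i j) \<le> mnorm ?Z m x + mnorm ?Z m y"
      proof (rule c0_mnorm_leI)
        fix k
        have "mnorm V m (\<lambda>i j. (x i j + y i j) k) \<le> mnorm V m (\<lambda>i j. x i j k) + mnorm V m (\<lambda>i j. y i j k)"
          using mnorm_triangle[OF m xk matrices_over_c0_coord[OF y]] by simp
        also have "\<dots> \<le> mnorm ?Z m x + mnorm ?Z m y"
          by (intro add_mono mnorm_coord_le_c0 m x y)
        finally show "mnorm V m (\<lambda>i j. (x i j + y i j) k) \<le> mnorm ?Z m x + mnorm ?Z m y" .
      qed
    }
    have zero: "mnorm ?Z m z = 0" if "\<forall>i<m. \<forall>j<m. z i j = 0" for z :: "nat \<Rightarrow> nat \<Rightarrow> nat \<Rightarrow> 'a"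
    proof -
      have "mnorm V m (\<lambda>i j. z i j k) = mnorm V m (\<lambda>i j. 0)" for k
        by (rule mnorm_cong[symmetric, OF m matrices_over_0]) (simp add: that)
      then show ?thesis by (simp add: c0_mnorm mnorm_0 m)
    qed
    show "mnorm ?Z m (\<lambda>i j. scl ?Z c (x i j)) = cmod c * mnorm ?Z m x"
    proof (cases "c = 0")
      case True
      then show ?thesis using zero[of "\<lambda>i j. 0"] by simp
    next
      case False
      have coord: "mnorm V m (\<lambda>i j. scl ?Z c (x i j) k) = cmod c * mnorm V m (\<lambda>i j. x i j k)" for k
        using mnorm_scl[OF m xk] by simp
      have "mnorm ?Z m x \<le> mnorm ?Z m (\<lambda>i j. scl ?Z c (x i j)) / cmod c"
      proof (rule c0_mnorm_leI)
        fix k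
        show "mnorm V m (\<lambda>i j. x i j k) \<le> mnorm ?Z m (\<lambda>i j. scl ?Z c (x i j)) / cmod c"
          using mnorm_coord_le_c0[OF m scx, of k] False unfolding coord by (simp add: field_simps)
      qed
      moreover have "mnorm ?Z m (\<lambda>i j. scl ?Z c (x i j)) \<le> cmod c * mnorm ?Z m x"
        by (rule c0_mnorm_leI) (auto simp only: coord intro!: mult_left_mono mnorm_coord_le_c0 m x norm_ge_zero)
      ultimately show ?thesis using False by (simp add: field_simps)
    qed
    show "mnorm ?Z m x = 0 \<longleftrightarrow> (\<forall>i<m. \<forall>j<m. x i j = 0)"
    proof
      assume 0: "mnorm ?Z m x = 0"
      have "mnorm V m (\<lambda>i j. x i j k) = 0" for k
        using mnorm_coord_le_c0[OF m x, of k] mnorm_nonneg[OF m xk, of k] 0 by linarith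
      then have "\<forall>i<m. \<forall>j<m. x i j k = 0" for k
        using mnorm_eq_0_iff[OF m xk] by blast
      then show "\<forall>i<m. \<forall>j<m. x i j = 0" by (auto simp: fun_eq_iff)
    qed (rule zero)
  }
  {
    assume p: "0 < p" and q: "0 < q" and x: "x \<in> matrices_over ?Z p"
    note xk = matrices_over_c0_coord[OF x]
    show "mnorm ?Z q (mat_sandwich ?Z p a x b)
        \<le> scalar_mat_norm q p a * mnorm ?Z p x * scalar_mat_norm p q b"
    proof (rule c0_mnorm_leI)
      fix k
      have "mnorm V q (\<lambda>i j. mat_sandwich ?Z p a x b i j k)
          \<le> scalar_mat_norm q p a * mnorm V p (\<lambda>i j. x i j k) * scalar_mat_norm p q b"
        unfolding mat_sandwich_c0_coord using mnorm_sandwich[OF p q xk] .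
      also have "\<dots> \<le> scalar_mat_norm q p a * mnorm ?Z p x * scalar_mat_norm p q b"
        by (intro mult_left_mono mult_right_mono mnorm_coord_le_c0 p x scalar_mat_norm_nonneg)
      finally show "mnorm V q (\<lambda>i j. mat_sandwich ?Z p a x b i j k)
          \<le> scalar_mat_norm q p a * mnorm ?Z p x * scalar_mat_norm p q b" .
    qed
    assume y: "y \<in> matrices_over ?Z q"
    note yk = matrices_over_c0_coord[OF y]
    have D: "mat_dsum p x y \<in> matrices_over ?Z (p + q)"
      using x y subspace_c0 c0.subspace_0 by (auto simp only: matrices_over_def mat_dsum_def split: if_splits)
    have coord: "mnorm V (p + q) (\<lambda>i j. mat_dsum p x y i j k)
        = max (mnorm V p (\<lambda>i j. x i j k)) (mnorm V q (\<lambda>i j. y i j k))" for k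
      unfolding mat_dsum_coord by (rule mnorm_dsum[OF p q xk yk])
    show "mnorm ?Z (p + q) (mat_dsum p x y) = max (mnorm ?Z p x) (mnorm ?Z q y)"
    proof (rule antisym)
      show "mnorm ?Z (p + q) (mat_dsum p x y) \<le> max (mnorm ?Z p x) (mnorm ?Z q y)"
        by (rule c0_mnorm_leI) (simp only: coord max.mono mnorm_coord_le_c0 p q x y)
      have le: "max (mnorm V p (\<lambda>i j. x i j k)) (mnorm V q (\<lambda>i j. y i j k))
          \<le> mnorm ?Z (p + q) (mat_dsum p x y)" for k
        using mnorm_coord_le_c0[OF _ D, of k] p unfolding coord by simp
      show "max (mnorm ?Z p x) (mnorm ?Z q y) \<le> mnorm ?Z (p + q) (mat_dsum p x y)"
        using le by (intro max.boundedI c0_mnorm_leI) auto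
    qed
  }
qed

lemma vnorm_coord_le_c0: "f \<in> space_carrier (c0_space V) \<Longrightarrow> vnorm V (f k) \<le> vnorm (c0_space V) f"
  unfolding vnorm_def by (rule mnorm_coord_le_c0) (auto simp: matrices_over_def vnorm_def)

end

text \<open>
  A Cauchy sequence of null sequences converges in every coordinate, and it does so uniformly in
  the coordinate; a uniform limit of null sequences is a null sequence.
\<close>
theorem operator_space_c0:
  fixes V :: "'a::ab_group_add op_space"
  assumes "operator_space V"
  shows "operator_space (c0_space V)"
proof -
  interpret V: matrix_normed_space V using assms by (simp add: operator_space_iff)
  interpret Z: matrix_normed_space "c0_space V" by (rule V.matrix_normed_space_c0)
  let ?Z = "c0_space V"
  have "Z.met.mcomplete"
  proof (rule Z.mcompleteI)
    fix \<sigma> :: "nat \<Rightarrow> nat \<Rightarrow> 'a"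
    assume \<sigma>: "\<And>n. \<sigma> n \<in> space_carrier ?Z"
      and C: "\<And>e. e > 0 \<Longrightarrow> \<exists>N. \<forall>n\<ge>N. \<forall>k\<ge>N. vnorm ?Z (\<sigma> n - \<sigma> k) < e"
    have \<sigma>c: "\<sigma> n k \<in> space_carrier V" for n k using \<sigma>[of n] by simp
    have coord: "vnorm V (\<sigma> n k - \<sigma> j k) \<le> vnorm ?Z (\<sigma> n - \<sigma> j)" for n j k
      using V.vnorm_coord_le_c0[OF Z.carrier_diff[OF \<sigma> \<sigma>], of n j k] by simp
    have "\<exists>l\<in>space_carrier V. (\<lambda>n. vnorm V (\<sigma> n k - l)) \<longlonglongrightarrow> 0" for k
    proof (rule V.mcompleteD)
      show "V.met.mcomplete" using assms by (simp add: operator_space_iff)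
      fix e :: real assume "e > 0"
      then obtain N where "\<forall>n\<ge>N. \<forall>j\<ge>N. vnorm ?Z (\<sigma> n - \<sigma> j) < e" using C by blast
      then show "\<exists>N. \<forall>n\<ge>N. \<forall>j\<ge>N. vnorm V (\<sigma> n k - \<sigma> j k) < e"
        using coord order.strict_trans1 by blast
    qed (rule \<sigma>c)
    then obtain l where l: "\<And>k. l k \<in> space_carrier V"
      and lim: "\<And>k. (\<lambda>n. vnorm V (\<sigma> n k - l k)) \<longlonglongrightarrow> 0" by metis
    have unif: "\<exists>N. \<forall>n\<ge>N. \<forall>k. vnorm V (\<sigma> n k - l k) \<le> e" if "e > 0" for e
    proof -
      obtain N where N: "\<forall>n\<ge>N. \<forall>j\<ge>N. vnorm ?Z (\<sigma> n - \<sigma> j) < e" using C \<open>e > 0\<close> by blast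
      have "vnorm V (\<sigma> n k - l k) \<le> e" if "n \<ge> N" for n k
      proof (rule tendsto_lowerbound)
        show "(\<lambda>j. e + vnorm V (\<sigma> j k - l k)) \<longlonglongrightarrow> e"
          using tendsto_add[OF tendsto_const lim, of e k] by simp
        show "\<forall>\<^sub>F j in sequentially. vnorm V (\<sigma> n k - l k) \<le> e + vnorm V (\<sigma> j k - l k)"
        proof (rule eventually_sequentiallyI)
          fix j assume "N \<le> j"
          then have "vnorm V (\<sigma> n k - \<sigma> j k) \<le> e"
            using N \<open>n \<ge> N\<close> coord[of n k j] by force
          then show "vnorm V (\<sigma> n k - l k) \<le> e + vnorm V (\<sigma> j k - l k)"
            using V.vnorm_diff_triangle[OF \<sigma>c \<sigma>c l, of n k k j k] by linarith
        qed
      qed simp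
      then show ?thesis by blast
    qed
    have "(\<lambda>k. vnorm V (l k)) \<longlonglongrightarrow> 0"
    proof (rule LIMSEQ_I)
      fix r :: real assume "r > 0"
      then obtain n where n: "\<And>k. vnorm V (\<sigma> n k - l k) \<le> r / 2" using unif[of "r / 2"] by auto
      have "(\<lambda>k. vnorm V (\<sigma> n k)) \<longlonglongrightarrow> 0" using \<sigma>[of n] by simp
      then obtain K where K: "\<And>k. k \<ge> K \<Longrightarrow> norm (vnorm V (\<sigma> n k) - 0) < r / 2"
        using \<open>r > 0\<close> LIMSEQ_D[of _ 0 "r / 2"] by (metis half_gt_zero)
      have "norm (vnorm V (l k) - 0) < r" if "k \<ge> K" for k
      proof -
        have "vnorm V (l k) \<le> vnorm V (l k - \<sigma> n k) + vnorm V (\<sigma> n k)"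
          using V.vnorm_diff_triangle[OF l \<sigma>c V.carrier_0, of k n k] by simp
        also have "vnorm V (l k - \<sigma> n k) = vnorm V (\<sigma> n k - l k)"
          by (rule V.vnorm_diff_commute[OF l \<sigma>c])
        finally show ?thesis using n[of k] K[OF that] V.vnorm_nonneg[OF l, of k] by simp
      qed
      then show "\<exists>no. \<forall>k\<ge>no. norm (vnorm V (l k) - 0) < r" by blast
    qed
    then have lZ: "l \<in> space_carrier ?Z" using l by simp
    have "(\<lambda>n. vnorm ?Z (\<sigma> n - l)) \<longlonglongrightarrow> 0"
    proof (rule LIMSEQ_I)
      fix r :: real assume "r > 0"
      then obtain N where N: "\<And>n k. n \<ge> N \<Longrightarrow> vnorm V (\<sigma> n k - l k) \<le> r / 2"
        using unif[of "r / 2"] by auto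
      have "norm (vnorm ?Z (\<sigma> n - l) - 0) < r" if "n \<ge> N" for n
      proof -
        have "vnorm ?Z (\<sigma> n - l) \<le> r / 2"
          unfolding vnorm_def by (rule c0_mnorm_leI) (use N[OF that] in \<open>simp add: vnorm_def\<close>)
        then show ?thesis
          using Z.vnorm_nonneg[OF Z.carrier_diff[OF \<sigma> lZ], of n] \<open>r > 0\<close> by simp
      qed
      then show "\<exists>no. \<forall>n\<ge>no. norm (vnorm ?Z (\<sigma> n - l) - 0) < r" by blast
    qed
    with lZ show "\<exists>l\<in>space_carrier ?Z. (\<lambda>n. vnorm ?Z (\<sigma> n - l)) \<longlonglongrightarrow> 0" by blast
  qed
  then show ?thesis by (simp add: operator_space_iff Z.matrix_normed_space_axioms)
qed

section \<open>The Hahn-Banach theorem\<close>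

text \<open>
  Functionals are represented by their graphs \<open>G\<close>.  The value \<open>c\<close> at the new vector \<open>y\<close> has
  to lie above all \<open>t - p (x - y)\<close> and below all \<open>p (x + y) - t\<close>, which is possible by
  subadditivity; by homogeneity of \<open>p\<close> the multiples \<open>r y\<close> reduce to \<open>r = 1\<close> and \<open>r = -1\<close>.
\<close>
lemma Hahn_Banach_one_step:
  fixes s :: "real \<Rightarrow> 'v::ab_group_add \<Rightarrow> 'v" and p :: "'v \<Rightarrow> real"
  assumes vs: "vector_space s" and W: "module.subspace s W"
    and p_add: "\<And>x y. x \<in> W \<Longrightarrow> y \<in> W \<Longrightarrow> p (x + y) \<le> p x + p y"
    and p_scale: "\<And>c x. c > 0 \<Longrightarrow> x \<in> W \<Longrightarrow> p (s c x) = c * p x"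
    and GW: "\<And>x t. (x, t) \<in> G \<Longrightarrow> x \<in> W" and G0: "(0, 0) \<in> G"
    and G_add: "\<And>x t y u. (x, t) \<in> G \<Longrightarrow> (y, u) \<in> G \<Longrightarrow> (x + y, t + u) \<in> G"
    and G_scale: "\<And>c x t. (x, t) \<in> G \<Longrightarrow> (s c x, c * t) \<in> G"
    and G_le: "\<And>x t. (x, t) \<in> G \<Longrightarrow> t \<le> p x"
    and y: "y \<in> W"
  shows "\<exists>c. \<forall>x t r. (x, t) \<in> G \<longrightarrow> t + r * c \<le> p (x + s r y)"
proof -
  interpret vector_space s by (rule vs)
  note W_rules = subspace_add[OF W] subspace_diff[OF W] subspace_scale[OF W]
  let ?A = "{t - p (x - y) | x t. (x, t) \<in> G}"
  have cross: "t - p (x - y) \<le> p (x' + y) - t'" if "(x, t) \<in> G" "(x', t') \<in> G" for x t x' t'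
  proof -
    have "t + t' \<le> p (x + x')" using G_le[OF G_add[OF that]] .
    also have "x + x' = (x - y) + (x' + y)" by simp
    also have "p \<dots> \<le> p (x - y) + p (x' + y)"
      using GW[OF that(1)] GW[OF that(2)] y by (intro p_add W_rules)
    finally show ?thesis by simp
  qed
  have ne: "?A \<noteq> {}" using G0 by blast
  have bdd: "bdd_above ?A" using cross[OF _ G0] by (intro bdd_aboveI) blast
  define c where "c = Sup ?A"
  have lower: "t - p (x - y) \<le> c" if "(x, t) \<in> G" for x t
    unfolding c_def using that by (intro cSup_upper bdd) blast
  have upper: "c \<le> p (x + y) - t" if "(x, t) \<in> G" for x t
    unfolding c_def using that cross by (intro cSup_least ne) blast
  have "t + r * c \<le> p (x + s r y)" if G: "(x, t) \<in> G" for x t r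
  proof (cases r "0::real" rule: linorder_cases)
    case equal
    then show ?thesis using G_le[OF G] by simp
  next
    case greater
    let ?x = "s (1 / r) x"
    have x: "?x \<in> W" using GW[OF G] by (rule W_rules)
    have "r * c \<le> r * (p (?x + y) - (1 / r) * t)"
      using greater upper[OF G_scale[OF G, of "1 / r"]] by (intro mult_left_mono) auto
    also have "\<dots> = p (s r (?x + y)) - t"
      using greater p_scale[of r "?x + y"] W_rules(1)[OF x y] by (simp add: algebra_simps)
    also have "s r (?x + y) = x + s r y" using greater by (simp add: scale_right_distrib)
    finally show ?thesis by simp
  next
    case less
    let ?x = "s (1 / - r) x"
    have x: "?x \<in> W" using GW[OF G] by (rule W_rules)
    have "- r * ((1 / - r) * t - p (?x - y)) \<le> - r * c"
      using less lower[OF G_scale[OF G, of "1 / - r"]] by (intro mult_left_mono) auto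
    moreover have "- r * ((1 / - r) * t - p (?x - y)) = t - p (s (- r) (?x - y))"
      using less p_scale[of "- r" "?x - y"] W_rules(2)[OF x y] by (simp add: algebra_simps)
    moreover have "s (- r) (?x - y) = x + s r y" using less by (simp add: scale_right_diff_distrib)
    ultimately show ?thesis by simp
  qed
  then show ?thesis by blast
qed

text \<open>
  Zorn's lemma is applied to the linear subspaces \<open>G\<close> of \<open>W \<times> \<real>\<close> that lie below the graph of
  \<open>p\<close> and contain the graph of \<open>f\<close>.  Such a \<open>G\<close> is automatically the graph of a function: if
  \<open>(0, t)\<close> lies in \<open>G\<close>, then so do its multiples, and \<open>k t \<le> p 0 = 0\<close> for all \<open>k\<close> forces
  \<open>t = 0\<close>.  The scalar multiplication is a parameter because the vectors below are matrices
  over an operator space, whose scalar multiplication is a field of a record.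
\<close>
theorem Hahn_Banach:
  fixes s :: "real \<Rightarrow> 'v::ab_group_add \<Rightarrow> 'v" and p f :: "'v \<Rightarrow> real"
  assumes vs: "vector_space s" and W: "module.subspace s W" and S: "module.subspace s S"
    and SW: "S \<subseteq> W"
    and p_add: "\<And>x y. x \<in> W \<Longrightarrow> y \<in> W \<Longrightarrow> p (x + y) \<le> p x + p y"
    and p_scale: "\<And>c x. c > 0 \<Longrightarrow> x \<in> W \<Longrightarrow> p (s c x) = c * p x"
    and f_add: "\<And>x y. x \<in> S \<Longrightarrow> y \<in> S \<Longrightarrow> f (x + y) = f x + f y"
    and f_scale: "\<And>c x. x \<in> S \<Longrightarrow> f (s c x) = c * f x"
    and f_le: "\<And>x. x \<in> S \<Longrightarrow> f x \<le> p x"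
  shows "\<exists>g. (\<forall>x\<in>W. \<forall>y\<in>W. g (x + y) = g x + g y) \<and> (\<forall>c. \<forall>x\<in>W. g (s c x) = c * g x)
    \<and> (\<forall>x\<in>S. g x = f x) \<and> (\<forall>x\<in>W. g x \<le> p x)"
proof -
  interpret vector_space s by (rule vs)
  define lin where "lin G \<longleftrightarrow> (\<forall>x t. (x, t) \<in> G \<longrightarrow> x \<in> W \<and> t \<le> p x)
    \<and> (\<forall>x t y u. (x, t) \<in> G \<longrightarrow> (y, u) \<in> G \<longrightarrow> (x + y, t + u) \<in> G)
    \<and> (\<forall>c x t. (x, t) \<in> G \<longrightarrow> (s c x, c * t) \<in> G) \<and> (\<forall>x\<in>S. (x, f x) \<in> G)" for G
  have "\<exists>M\<in>{G. lin G}. \<forall>X\<in>{G. lin G}. M \<subseteq> X \<longrightarrow> X = M"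
  proof (rule subset_Zorn_nonempty)
    have "lin ((\<lambda>x. (x, f x)) ` S)"
      using SW f_le f_add f_scale subspace_add[OF S] subspace_scale[OF S]
      unfolding lin_def by (auto simp: image_iff)
    then show "{G. lin G} \<noteq> {}" by blast
  next
    fix K :: "('v \<times> real) set set" assume ne: "K \<noteq> {}" and ch: "subset.chain {G. lin G} K"
    have mem: "lin G" if "G \<in> K" for G using ch that by (auto simp: subset_chain_def)
    have "(x + y, t + u) \<in> \<Union> K" if "(x, t) \<in> G" "G \<in> K" "(y, u) \<in> H" "H \<in> K" for x t y u G H
    proof -
      have "G \<subseteq> H \<or> H \<subseteq> G" using ch that by (auto simp: subset_chain_def)
      then show ?thesis using that mem unfolding lin_def by (meson UnionI subsetD)
    qed
    then show "\<Union> K \<in> {G. lin G}"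
      using ne mem unfolding lin_def by (simp add: Bex_def Ball_def) (meson ex_in_conv)
  qed
  then obtain G where G: "lin G" and max: "\<And>X. lin X \<Longrightarrow> G \<subseteq> X \<Longrightarrow> X = G" by blast
  have GW: "x \<in> W" and G_le: "t \<le> p x" if "(x, t) \<in> G" for x t
    using G that unfolding lin_def by blast+
  have G_add: "(x + y, t + u) \<in> G" if "(x, t) \<in> G" "(y, u) \<in> G" for x t y u
    using G that unfolding lin_def by blast
  have G_scale: "(s c x, c * t) \<in> G" if "(x, t) \<in> G" for c x t
    using G that unfolding lin_def by blast
  have G_f: "(x, f x) \<in> G" if "x \<in> S" for x using G that unfolding lin_def by blast
  have G0: "(0, 0) \<in> G" using G_scale[OF G_f[OF subspace_0[OF S]], of 0] by simp
  have p0: "p 0 = 0" using p_scale[of 2 0] subspace_0[OF W] by simp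
  have total: "\<exists>t. (y, t) \<in> G" if y: "y \<in> W" for y
  proof -
    have "\<exists>c. \<forall>x t r. (x, t) \<in> G \<longrightarrow> t + r * c \<le> p (x + s r y)"
      by (rule Hahn_Banach_one_step[OF vs W]) (fact p_add p_scale GW G0 G_add G_scale G_le y)+
    then obtain c where c: "\<And>x t r. (x, t) \<in> G \<Longrightarrow> t + r * c \<le> p (x + s r y)" by blast
    let ?H = "{(x + s r y, t + r * c) | x t r. (x, t) \<in> G}"
    have H: "(x + s r y, t + r * c) \<in> ?H" if "(x, t) \<in> G" for x t r using that by blast
    have "G \<subseteq> ?H"
    proof clarify
      fix x t assume G: "(x, t) \<in> G"
      show "\<exists>x' t' r. (x, t) = (x' + s r y, t' + r * c) \<and> (x', t') \<in> G"
        using G by (intro exI[of _ x] exI[of _ t] exI[of _ 0]) simp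
    qed
    moreover have "lin ?H"
      unfolding lin_def
    proof (intro conjI allI impI ballI)
      fix x t assume "(x, t) \<in> ?H"
      then obtain x' t' r where *: "x = x' + s r y" "t = t' + r * c" "(x', t') \<in> G" by blast
      show "x \<in> W" unfolding * by (intro subspace_add[OF W] subspace_scale[OF W] y GW[OF *(3)])
      show "t \<le> p x" unfolding * by (rule c[OF *(3)])
      fix k
      have "(s k x' + s (k * r) y, k * t' + (k * r) * c) \<in> ?H" by (intro H G_scale *)
      then show "(s k x, k * t) \<in> ?H" unfolding * by (simp add: scale_right_distrib distrib_left mult.assoc)
      fix z u assume "(z, u) \<in> ?H"
      then obtain z' u' q where **: "z = z' + s q y" "u = u' + q * c" "(z', u') \<in> G" by blast
      have "(x' + z' + s (r + q) y, t' + u' + (r + q) * c) \<in> ?H" by (intro H G_add * **)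
      then show "(x + z, t + u) \<in> ?H" unfolding * **
        by (simp add: scale_left_distrib distrib_right add_ac)
    next
      fix x assume "x \<in> S"
      from \<open>G \<subseteq> ?H\<close> G_f[OF this] show "(x, f x) \<in> ?H" by blast
    qed
    ultimately have "?H = G" by (intro max)
    moreover have "(y, c) \<in> ?H" using H[OF G0, of 1] by simp
    ultimately show ?thesis by blast
  qed
  have unique: "t = u" if "(x, t) \<in> G" "(x, u) \<in> G" for x t u
  proof -
    have *: "(0, k * (t - u)) \<in> G" for k
      using G_scale[OF G_add[OF that(1) G_scale[OF that(2), of "-1"]], of k] by simp
    have "k * (t - u) \<le> 0" for k using G_le[OF *] p0 by simp
    from this[of "1"] this[of "-1"] show ?thesis by simp
  qed
  define g where "g x = (THE t. (x, t) \<in> G)" for x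
  have g: "g x = t" if "(x, t) \<in> G" for x t
    unfolding g_def using that unique by blast
  have gG: "(x, g x) \<in> G" if "x \<in> W" for x using total[OF that] g by blast
  show ?thesis
    by (intro exI[of _ g] conjI ballI allI g G_add G_scale gG G_f G_le)
qed

section \<open>Gram-Schmidt factorization of scalar matrices\<close>

definition herm_prod :: "nat \<Rightarrow> (nat \<Rightarrow> complex) \<Rightarrow> (nat \<Rightarrow> complex) \<Rightarrow> complex" where
  "herm_prod m u v = (\<Sum>j<m. u j * cnj (v j))"

lemma herm_prod_commute: "cnj (herm_prod m u v) = herm_prod m v u"
  by (simp add: herm_prod_def cnj_sum mult.commute)

lemma herm_prod_self: "herm_prod m u u = of_real ((l2 m u)\<^sup>2)"
  by (simp only: herm_prod_def l2_square complex_norm_square of_real_sum)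

lemma herm_prod_diff: "herm_prod m (\<lambda>j. u j - v j) w = herm_prod m u w - herm_prod m v w"
  by (simp add: herm_prod_def left_diff_distrib sum_subtractf)

lemma herm_prod_scale: "herm_prod m (\<lambda>j. c * u j) w = c * herm_prod m u w"
  by (simp add: herm_prod_def sum_distrib_left mult.assoc)

lemma herm_prod_sum: "herm_prod m (\<lambda>j. \<Sum>k\<in>K. c k * q k j) w = (\<Sum>k\<in>K. c k * herm_prod m (q k) w)"
  by (simp add: herm_prod_def sum_distrib_left sum_distrib_right mult.assoc sum.swap[of _ K])

lemma herm_prod_0_right: "l2 m v = 0 \<Longrightarrow> herm_prod m u v = 0"
  by (simp add: herm_prod_def L2_set_eq_0_iff)

lemma orthogonal_expansion_l2:
  fixes n :: nat
  assumes "\<And>k l. k < n \<Longrightarrow> l < n \<Longrightarrow> k \<noteq> l \<Longrightarrow> herm_prod m (q k) (q l) = 0"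
  shows "(l2 m (\<lambda>j. \<Sum>k<n. c k * q k j))\<^sup>2 = (\<Sum>k<n. (cmod (c k))\<^sup>2 * (l2 m (q k))\<^sup>2)"
proof -
  let ?v = "\<lambda>j. \<Sum>k<n. c k * q k j"
  have qv: "herm_prod m (q k) ?v = cnj (c k) * of_real ((l2 m (q k))\<^sup>2)" if "k < n" for k
  proof -
    have "herm_prod m ?v (q k) = (\<Sum>l<n. c l * herm_prod m (q l) (q k))" by (rule herm_prod_sum)
    also have "\<dots> = (\<Sum>l<n. if l = k then c k * herm_prod m (q k) (q k) else 0)"
      using assms that by (intro sum.cong) auto
    also have "\<dots> = c k * herm_prod m (q k) (q k)" using that by (simp add: sum.delta)
    finally have "cnj (herm_prod m ?v (q k)) = cnj (c k * of_real ((l2 m (q k))\<^sup>2))" by (simp only: herm_prod_self)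
    then show ?thesis by (simp add: herm_prod_commute)
  qed
  have "herm_prod m ?v ?v = (\<Sum>k<n. c k * herm_prod m (q k) ?v)" by (rule herm_prod_sum)
  also have "\<dots> = (\<Sum>k<n. of_real ((cmod (c k))\<^sup>2 * (l2 m (q k))\<^sup>2))"
    by (intro sum.cong refl) (simp only: qv lessThan_iff complex_norm_square of_real_mult mult.assoc)
  finally show ?thesis
    unfolding herm_prod_self of_real_sum[symmetric] of_real_eq_iff .
qed

text \<open>
  The rows \<open>q\<close> span the same space as the rows \<open>r\<close>, \<open>M\<close> expressing the former by the latter.
  Rows of \<open>q\<close> may vanish, so that there are exactly as many of them as rows of \<open>r\<close>, even if
  the latter are linearly dependent.
\<close>
definition orthonormalization ::
  "nat \<Rightarrow> nat \<Rightarrow> (nat \<Rightarrow> nat \<Rightarrow> complex) \<Rightarrow> (nat \<Rightarrow> nat \<Rightarrow> complex) \<Rightarrow> (nat \<Rightarrow> nat \<Rightarrow> complex) \<Rightarrow> bool" where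
  "orthonormalization n m r q M \<longleftrightarrow> (\<forall>i<n. \<forall>j<m. r i j = (\<Sum>k<n. herm_prod m (r i) (q k) * q k j))
    \<and> (\<forall>i<n. \<forall>j<m. q i j = (\<Sum>k<n. M i k * r k j))
    \<and> (\<forall>i<n. \<forall>k<n. i \<noteq> k \<longrightarrow> herm_prod m (q i) (q k) = 0)
    \<and> (\<forall>i<n. l2 m (q i) = 0 \<or> l2 m (q i) = 1)"

lemma orthonormalizationD:
  assumes "orthonormalization n m r q M"
  shows "\<And>i j. i < n \<Longrightarrow> j < m \<Longrightarrow> r i j = (\<Sum>k<n. herm_prod m (r i) (q k) * q k j)"
    and "\<And>i j. i < n \<Longrightarrow> j < m \<Longrightarrow> q i j = (\<Sum>k<n. M i k * r k j)"
    and "\<And>i k. i < n \<Longrightarrow> k < n \<Longrightarrow> i \<noteq> k \<Longrightarrow> herm_prod m (q i) (q k) = 0"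
    and "\<And>i. i < n \<Longrightarrow> l2 m (q i) = 0 \<or> l2 m (q i) = 1"
  using assms unfolding orthonormalization_def by simp_all

lemma gram_schmidt: "\<exists>q M. orthonormalization n m r q M"
proof (induction n)
  case 0
  show ?case by (simp add: orthonormalization_def)
next
  case (Suc n)
  then obtain q M where "orthonormalization n m r q M" by blast
  note rq = orthonormalizationD(1)[OF this] and qM = orthonormalizationD(2)[OF this]
    and orth = orthonormalizationD(3)[OF this] and unit = orthonormalizationD(4)[OF this]
  define c where "c k = herm_prod m (r n) (q k)" for k
  define s where "s j = r n j - (\<Sum>k<n. c k * q k j)" for j
  define N where "N = l2 m s"
  have s_orth: "herm_prod m s (q k) = 0" if "k < n" for k
  proof -
    have "herm_prod m s (q k) = c k - (\<Sum>l<n. c l * herm_prod m (q l) (q k))"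
      unfolding s_def herm_prod_diff herm_prod_sum by (simp add: c_def)
    also have "(\<Sum>l<n. c l * herm_prod m (q l) (q k)) = (\<Sum>l<n. if l = k then c k * herm_prod m (q k) (q k) else 0)"
      using orth that by (intro sum.cong) auto
    also have "\<dots> = c k * herm_prod m (q k) (q k)" using that by (simp add: sum.delta)
    also have "\<dots> = c k"
      using unit[OF that] by (auto simp: herm_prod_self c_def herm_prod_0_right)
    finally show ?thesis by simp
  qed
  \<comment> \<open>as \<open>inverse 0 = 0\<close>, this is the zero row if the residual \<open>s\<close> vanishes\<close>
  define qn where "qn j = of_real (inverse N) * s j" for j
  have sN: "s j = of_real N * qn j" if "j < m" for j
  proof (cases "N = 0")
    case True
    then have "s j = 0" using that unfolding N_def by (simp add: L2_set_eq_0_iff)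
    then show ?thesis using True by simp
  qed (simp add: qn_def)
  have qn_l2: "l2 m qn = \<bar>inverse N\<bar> * N"
    unfolding qn_def N_def by (simp add: norm_mult norm_inverse L2_set_right_distrib)
  have qn_unit: "l2 m qn = 0 \<or> l2 m qn = 1"
    unfolding qn_l2 using L2_set_nonneg[of "\<lambda>j. norm (s j)" "{..<m}"]
    by (cases "N = 0") (simp_all add: N_def[symmetric])
  have qn_orth: "herm_prod m qn (q k) = 0" "herm_prod m (q k) qn = 0" if "k < n" for k
  proof -
    show *: "herm_prod m qn (q k) = 0" unfolding qn_def herm_prod_scale using s_orth[OF that] by simp
    show "herm_prod m (q k) qn = 0" using herm_prod_commute[of m qn "q k"] * by simp
  qed
  have herm_prod_r_qn: "herm_prod m (r i) qn = 0" if "i < n" for i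
  proof -
    have "herm_prod m (r i) qn = herm_prod m (\<lambda>j. \<Sum>k<n. herm_prod m (r i) (q k) * q k j) qn"
      unfolding herm_prod_def[of m _ qn] using rq[OF that] by (intro sum.cong) auto
    also have "\<dots> = 0" unfolding herm_prod_sum using qn_orth by simp
    finally show ?thesis .
  qed
  have herm_prod_rn_qn: "herm_prod m (r n) qn * qn j = s j" if j: "j < m" for j
  proof -
    have "herm_prod m (r n) qn = herm_prod m s qn + (\<Sum>k<n. c k * herm_prod m (q k) qn)"
      unfolding s_def herm_prod_diff herm_prod_sum by simp
    also have "\<dots> = herm_prod m (\<lambda>j. of_real N * qn j) qn"
      using qn_orth sN by (simp add: herm_prod_def)
    also have "\<dots> = of_real (N * (l2 m qn)\<^sup>2)"
      unfolding herm_prod_scale herm_prod_self by simp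
    also have "\<dots> = of_real N"
      unfolding qn_l2 using L2_set_nonneg[of "\<lambda>j. norm (s j)" "{..<m}"]
      by (cases "N = 0") (simp_all add: N_def[symmetric])
    finally show ?thesis using sN[OF j] by simp
  qed
  define Q where "Q k = (if k = n then qn else q k)" for k
  define D where "D l = (\<Sum>k<n. c k * M k l)" for l
  define M' where "M' i k = (if i = n then of_real (inverse N) *
      (if k = n then 1 else - D k) else if k = n then 0 else M i k)" for i k
  have Q_lt: "Q k = q k" if "k < n" for k using that by (simp add: Q_def)
  have Q_n: "Q n = qn" by (simp add: Q_def)
  show ?case
    unfolding orthonormalization_def
  proof (rule exI[of _ Q], rule exI[of _ M'], intro conjI allI impI)
    fix i j assume i: "i < Suc n" and j: "j < m"
    have split: "(\<Sum>k<Suc n. herm_prod m (r i) (Q k) * Q k j)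
        = (\<Sum>k<n. herm_prod m (r i) (q k) * q k j) + herm_prod m (r i) qn * qn j"
      by (simp add: Q_lt Q_n)
    show "r i j = (\<Sum>k<Suc n. herm_prod m (r i) (Q k) * Q k j)"
    proof (cases "i = n")
      case True
      then show ?thesis unfolding split using herm_prod_rn_qn[OF j] by (simp add: s_def c_def)
    next
      case False
      then have "i < n" using i by simp
      then show ?thesis unfolding split using rq[of i j] j herm_prod_r_qn[of i] by simp
    qed
    show "Q i j = (\<Sum>k<Suc n. M' i k * r k j)"
    proof (cases "i = n")
      case True
      have "(\<Sum>k<n. c k * q k j) = (\<Sum>k<n. \<Sum>l<n. c k * (M k l * r l j))"
        using qM j by (simp add: sum_distrib_left)
      also have "\<dots> = (\<Sum>l<n. D l * r l j)"
        by (subst sum.swap) (simp add: D_def sum_distrib_right mult.assoc)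
      finally have "s j = r n j - (\<Sum>l<n. D l * r l j)" by (simp add: s_def)
      then show ?thesis
        using True
        by (simp add: Q_n qn_def M'_def sum_distrib_left sum_negf right_diff_distrib mult.assoc)
    next
      case False
      then have "i < n" using i by simp
      then show ?thesis using qM[of i j] j by (simp add: Q_lt M'_def)
    qed
  next
    fix i k assume "i < Suc n" "k < Suc n" "i \<noteq> k"
    then show "herm_prod m (Q i) (Q k) = 0"
      by (cases "i = n"; cases "k = n") (auto simp: Q_def qn_orth orth)
  next
    fix i assume "i < Suc n"
    then show "l2 m (Q i) = 0 \<or> l2 m (Q i) = 1"
      by (cases "i = n") (use qn_unit unit in \<open>auto simp: Q_def\<close>)
  qed
qed

definition hs_norm_sq :: "nat \<Rightarrow> nat \<Rightarrow> (nat \<Rightarrow> nat \<Rightarrow> complex) \<Rightarrow> real" where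
  "hs_norm_sq p q a = (\<Sum>i<p. \<Sum>j<q. (cmod (a i j))\<^sup>2)"

lemma cmod_dot_le: "cmod (\<Sum>j<m. u j * v j) \<le> l2 m u * l2 m v"
proof -
  have "cmod (\<Sum>j<m. u j * v j) \<le> (\<Sum>j<m. \<bar>cmod (u j)\<bar> * \<bar>cmod (v j)\<bar>)"
    by (rule order_trans[OF norm_sum]) (simp add: norm_mult)
  also have "\<dots> \<le> l2 m u * l2 m v" by (rule L2_set_mult_ineq)
  finally show ?thesis .
qed

text \<open>
  Duality: with \<open>w = q v\<close>, the square of the length of \<open>w\<close> is the pairing of \<open>v\<close> with the
  image of the conjugate of \<open>w\<close> under the transpose of \<open>q\<close>.
\<close>
lemma contraction_transpose:
  fixes q :: "nat \<Rightarrow> nat \<Rightarrow> complex"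
  assumes "\<And>c. l2 m (\<lambda>j. \<Sum>k<n. q k j * c k) \<le> l2 n c"
  shows "l2 n (\<lambda>k. \<Sum>j<m. q k j * v j) \<le> l2 m v"
proof -
  define w where "w k = (\<Sum>j<m. q k j * v j)" for k
  have "of_real ((l2 n w)\<^sup>2) = (\<Sum>k<n. w k * cnj (w k))"
    using herm_prod_self[of n w] by (simp add: herm_prod_def)
  also have "\<dots> = (\<Sum>k<n. \<Sum>j<m. q k j * v j * cnj (w k))"
    by (simp add: w_def[of "_ :: nat"] sum_distrib_right)
  also have "\<dots> = (\<Sum>j<m. (\<Sum>k<n. q k j * cnj (w k)) * v j)"
    by (subst sum.swap) (simp add: sum_distrib_left sum_distrib_right mult_ac)
  finally have "(l2 n w)\<^sup>2 = cmod (\<Sum>j<m. (\<Sum>k<n. q k j * cnj (w k)) * v j)"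
    by (metis norm_of_real abs_power2)
  also have "\<dots> \<le> l2 m (\<lambda>j. \<Sum>k<n. q k j * cnj (w k)) * l2 m v" by (rule cmod_dot_le)
  also have "\<dots> \<le> l2 n (\<lambda>k. cnj (w k)) * l2 m v"
    by (intro mult_right_mono assms) simp
  finally have "l2 n w * l2 n w \<le> l2 n w * l2 m v" by (simp add: power2_eq_square)
  then have "l2 n w \<le> l2 m v"
    using L2_set_nonneg[of "\<lambda>k. norm (w k)" "{..<n}"] L2_set_nonneg[of "\<lambda>k. norm (v k)" "{..<m}"]
    by (metis mult_le_cancel_left order_less_le)
  then show ?thesis unfolding w_def .
qed

text \<open>
  Gram-Schmidt replaces a wide matrix \<open>a\<close> by an n-by-n matrix \<open>L\<close> with the same
  Hilbert-Schmidt norm, at the cost of a contraction \<open>q\<close> on the right.  What makes this useful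
  for extensions is that \<open>q\<close> is in turn a multiple \<open>M a\<close> of \<open>a\<close>.
\<close>
lemma orthonormal_row_factorization:
  fixes a :: "nat \<Rightarrow> nat \<Rightarrow> complex"
  shows "\<exists>L q M. (\<forall>i<n. \<forall>j<m. a i j = (\<Sum>k<n. L i k * q k j))
    \<and> (\<forall>i<n. \<forall>j<m. q i j = (\<Sum>k<n. M i k * a k j))
    \<and> scalar_mat_norm n m q \<le> 1 \<and> scalar_mat_norm m n (\<lambda>j k. q k j) \<le> 1
    \<and> hs_norm_sq n n L = hs_norm_sq n m a"
proof -
  obtain q M where "orthonormalization n m a q M" using gram_schmidt by blast
  note rq = orthonormalizationD(1)[OF this] and qM = orthonormalizationD(2)[OF this]
    and orth = orthonormalizationD(3)[OF this] and unit = orthonormalizationD(4)[OF this]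
  define L where "L i k = herm_prod m (a i) (q k)" for i k
  have contr: "l2 m (\<lambda>j. \<Sum>k<n. q k j * c k) \<le> l2 n c" for c
  proof (rule power2_le_imp_le)
    have "(l2 m (\<lambda>j. \<Sum>k<n. q k j * c k))\<^sup>2 = (\<Sum>k<n. (cmod (c k))\<^sup>2 * (l2 m (q k))\<^sup>2)"
      using orthogonal_expansion_l2[OF orth, where c = c] by (simp add: mult.commute)
    also have "\<dots> \<le> (\<Sum>k<n. (cmod (c k))\<^sup>2)"
      using unit by (intro sum_mono) fastforce
    finally show "(l2 m (\<lambda>j. \<Sum>k<n. q k j * c k))\<^sup>2 \<le> (l2 n c)\<^sup>2" by (simp only: l2_square)
  qed simp
  have "hs_norm_sq n n L = hs_norm_sq n m a"
    unfolding hs_norm_sq_def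
  proof (rule sum.cong[OF refl])
    fix i assume "i \<in> {..<n}"
    then have i: "i < n" by simp
    have "(\<Sum>j<m. (cmod (a i j))\<^sup>2) = (l2 m (\<lambda>j. \<Sum>k<n. L i k * q k j))\<^sup>2"
      unfolding l2_square L_def using rq[OF i] by simp
    also have "\<dots> = (\<Sum>k<n. (cmod (L i k))\<^sup>2 * (l2 m (q k))\<^sup>2)"
      by (rule orthogonal_expansion_l2[OF orth])
    also have "\<dots> = (\<Sum>k<n. (cmod (L i k))\<^sup>2)"
      using unit herm_prod_0_right by (intro sum.cong) (fastforce simp: L_def)+
    finally show "(\<Sum>k<n. (cmod (L i k))\<^sup>2) = (\<Sum>j<m. (cmod (a i j))\<^sup>2)" by simp
  qed
  moreover have "scalar_mat_norm n m q \<le> 1"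
    using contraction_transpose[OF contr] by (intro scalar_mat_norm_leI) (meson order_trans)
  moreover have "scalar_mat_norm m n (\<lambda>j k. q k j) \<le> 1"
    using contr by (intro scalar_mat_norm_leI) (meson order_trans)
  moreover have "\<forall>i<n. \<forall>j<m. a i j = (\<Sum>k<n. L i k * q k j)"
    unfolding L_def using rq by simp
  moreover have "\<forall>i<n. \<forall>j<m. q i j = (\<Sum>k<n. M i k * a k j)"
    using qM by simp
  ultimately show ?thesis by (intro exI conjI)
qed

section \<open>A gauge dual to the completely bounded norm\<close>

text \<open>
  In contrast to a bound on \<^const>\<open>cb_norm\<close>, this also says that the supremum in the definition
  of \<^const>\<open>cb_norm\<close> is finite.
\<close>
definition cb_norm_le ::
  "'a::ab_group_add op_space \<Rightarrow> 'b::ab_group_add op_space \<Rightarrow> real \<Rightarrow> ('a \<Rightarrow> 'b) \<Rightarrow> bool" where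
  "cb_norm_le V W C T \<longleftrightarrow> linear_operator V W T \<and>
     (\<forall>m x. 0 < m \<longrightarrow> x \<in> matrices_over V m \<longrightarrow> mnorm V m x \<le> 1 \<longrightarrow> mnorm W m (\<lambda>i j. T (x i j)) \<le> C)"

lemma cb_norm_leD:
  "cb_norm_le V W C T \<Longrightarrow> 0 < m \<Longrightarrow> x \<in> matrices_over V m \<Longrightarrow> mnorm V m x \<le> 1
    \<Longrightarrow> mnorm W m (\<lambda>i j. T (x i j)) \<le> C"
  unfolding cb_norm_le_def by blast

lemma cb_norm_le_linear: "cb_norm_le V W C T \<Longrightarrow> linear_operator V W T"
  unfolding cb_norm_le_def by blast

lemma mat_sandwich_cong:
  assumes "\<And>k. k < m \<Longrightarrow> a i k = a' i k" "\<And>l. l < m \<Longrightarrow> b l j = b' l j"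
    "\<And>k l. k < m \<Longrightarrow> l < m \<Longrightarrow> x k l = x' k l"
  shows "mat_sandwich V m a x b i j = mat_sandwich V m a' x' b' i j"
  unfolding mat_sandwich_def using assms by (intro sum.cong) auto

lemma sum_swap4:
  "(\<Sum>p\<in>A. \<Sum>r\<in>B. \<Sum>k\<in>C. \<Sum>l\<in>D. f p r k l) = (\<Sum>k\<in>C. \<Sum>l\<in>D. \<Sum>p\<in>A. \<Sum>r\<in>B. f p r k l)"
proof -
  have "(\<Sum>p\<in>A. \<Sum>r\<in>B. \<Sum>k\<in>C. \<Sum>l\<in>D. f p r k l) = (\<Sum>p\<in>A. \<Sum>k\<in>C. \<Sum>l\<in>D. \<Sum>r\<in>B. f p r k l)"
    by (rule sum.cong[OF refl], rule trans[OF sum.swap], rule sum.cong[OF refl], rule sum.swap)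
  also have "\<dots> = (\<Sum>k\<in>C. \<Sum>l\<in>D. \<Sum>p\<in>A. \<Sum>r\<in>B. f p r k l)"
    by (rule trans[OF sum.swap], rule sum.cong[OF refl], rule sum.swap)
  finally show ?thesis .
qed

lemma Mn_sandwich_entry:
  "mat_sandwich Mn m a B b i j $ r $ s = (\<Sum>k<m. \<Sum>l<m. a i k * b l j * B k l $ r $ s)"
  by (simp add: mat_sandwich_def)

lemma inner_complex_vec: "inner x y = Re (\<Sum>r\<in>UNIV. cnj (x $ r) * y $ r)" for x y :: "complex^'n"
  by (simp add: inner_vec_def inner_complex_def)

text \<open>
  The matrix coefficients of \<open>B\<close>, acting as an operator, are the values of one fixed functional
  on n-by-n matrices over \<open>M\<^sub>n\<close>, the sum of the \<open>(i,j)\<close> entries of the \<open>(i,j)\<close> entries,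
  at the matrices \<open>a B b\<close>, where \<open>a\<close> and \<open>b\<close> list the coordinates of the two tuples of
  vectors.  The enumeration \<open>e\<close> is there because matrices over an operator space are indexed by
  naturals and those in \<open>M\<^sub>n\<close> by a finite type.
\<close>
lemma pairing_eq_sandwich:
  fixes B :: "nat \<Rightarrow> nat \<Rightarrow> complex^'n^'n" and \<xi> v :: "nat \<Rightarrow> complex^'n"
  assumes e: "bij_betw e {..<N} UNIV"
  shows "(\<Sum>k<m. inner (\<xi> k) (\<Sum>l<m. B k l *v v l))
    = Re (\<Sum>i<N. \<Sum>j<N. mat_sandwich Mn m (\<lambda>i k. cnj (\<xi> k $ e i)) B (\<lambda>l j. v l $ e j) i j $ e i $ e j)"
proof -
  let ?f = "\<lambda>r s k l. cnj (\<xi> k $ r) * v l $ s * B k l $ r $ s"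
  have "(\<Sum>i<N. \<Sum>j<N. mat_sandwich Mn m (\<lambda>i k. cnj (\<xi> k $ e i)) B (\<lambda>l j. v l $ e j) i j $ e i $ e j)
      = (\<Sum>i<N. \<Sum>j<N. \<Sum>k<m. \<Sum>l<m. ?f (e i) (e j) k l)"
    by (simp add: Mn_sandwich_entry)
  also have "\<dots> = (\<Sum>i<N. \<Sum>s\<in>UNIV. \<Sum>k<m. \<Sum>l<m. ?f (e i) s k l)"
    by (intro sum.cong refl sum.reindex_bij_betw[OF e])
  also have "\<dots> = (\<Sum>r\<in>UNIV. \<Sum>s\<in>UNIV. \<Sum>k<m. \<Sum>l<m. ?f r s k l)"
    by (rule sum.reindex_bij_betw[OF e])
  also have "\<dots> = (\<Sum>k<m. \<Sum>l<m. \<Sum>r\<in>UNIV. \<Sum>s\<in>UNIV. ?f r s k l)"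
    by (rule sum_swap4)
  also have "\<dots> = (\<Sum>k<m. \<Sum>l<m. \<Sum>r\<in>UNIV. cnj (\<xi> k $ r) * (B k l *v v l) $ r)"
    by (simp add: matrix_vector_mult_def sum_distrib_left mult_ac)
  finally show ?thesis
    unfolding inner_sum_right by (simp only: inner_complex_vec Re_sum)
qed

lemma sum_inner_le_l2: "(\<Sum>k<m. inner (\<xi> k) (w k)) \<le> l2 m \<xi> * l2 m w"
proof -
  have "(\<Sum>k<m. inner (\<xi> k) (w k)) \<le> (\<Sum>k<m. \<bar>norm (\<xi> k)\<bar> * \<bar>norm (w k)\<bar>)"
    by (intro sum_mono) (simp add: norm_cauchy_schwarz)
  also have "\<dots> \<le> l2 m \<xi> * l2 m w" by (rule L2_set_mult_ineq)
  finally show ?thesis .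
qed

lemma l2_leI_inner:
  assumes "0 \<le> C" "\<And>\<xi>. l2 m \<xi> \<le> 1 \<Longrightarrow> (\<Sum>k<m. inner (\<xi> k) (w k)) \<le> C"
  shows "l2 m w \<le> C"
proof (cases "l2 m w = 0")
  case True
  then show ?thesis using assms(1) by simp
next
  case False
  let ?c = "inverse (l2 m w)"
  have "l2 m (\<lambda>k. ?c *\<^sub>R w k) = 1"
    using False l2_scale[where c = ?c and v = w and m = m] by simp
  then have "(\<Sum>k<m. inner (?c *\<^sub>R w k) (w k)) \<le> C" by (intro assms(2)) simp
  moreover have "(\<Sum>k<m. inner (?c *\<^sub>R w k) (w k)) = ?c * (l2 m w)\<^sup>2"
    by (simp add: l2_square power2_norm_eq_inner sum_distrib_left)
  ultimately have "?c * (l2 m w)\<^sup>2 \<le> C" by linarith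
  then show ?thesis using False by (simp add: power2_eq_square flip: mult.assoc)
qed

context matrix_normed_space
begin

lemma restrict_matrix_normed_space:
  assumes "vs.subspace X" "X \<subseteq> space_carrier V"
  shows "matrix_normed_space (restrict_space_to V X)"
proof -
  have sub: "x \<in> matrices_over (restrict_space_to V X) m \<Longrightarrow> x \<in> matrices_over V m" for x m
    using assms(2) by (auto simp: matrices_over_def)
  have sw: "mat_sandwich (restrict_space_to V X) = mat_sandwich V"
    by (simp add: mat_sandwich_def fun_eq_iff)
  show ?thesis
    by (rule matrix_normed_space.intro)
       (simp_all add: vector_space_scl assms(1) sw sub mnorm_triangle mnorm_scl mnorm_eq_0_iff
         mnorm_dsum mnorm_sandwich)
qed

lemma linear_operator_0: "linear_operator V W T \<Longrightarrow> T 0 = 0"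
  using carrier_0 unfolding linear_operator_def by (metis add_cancel_right_left)

lemma linear_operator_sum:
  assumes "linear_operator V W T" "\<And>i. i \<in> I \<Longrightarrow> f i \<in> space_carrier V"
  shows "T (\<Sum>i\<in>I. f i) = (\<Sum>i\<in>I. T (f i))"
  using assms(2)
proof (induction I rule: infinite_finite_induct)
  case (insert i I)
  have "(\<Sum>i\<in>I. f i) \<in> space_carrier V" using insert.prems by (intro carrier_sum) auto
  then show ?case using insert assms(1) by (simp add: linear_operator_def)
qed (simp_all add: linear_operator_0[OF assms(1)])

lemma linear_operator_sandwich:
  assumes T: "linear_operator V W T" and x: "x \<in> matrices_over V m"
  shows "T (mat_sandwich V m a x b i j) = mat_sandwich W m a (\<lambda>k l. T (x k l)) b i j"
proof -
  have x': "x k l \<in> space_carrier V" if "k < m" "l < m" for k l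
    using x that by (simp add: matrices_over_def)
  have "T (mat_sandwich V m a x b i j) = (\<Sum>k<m. \<Sum>l<m. T (scl V (a i k * b l j) (x k l)))"
    unfolding mat_sandwich_def
    by (subst linear_operator_sum[OF T], use x' in \<open>force intro!: carrier_sum carrier_scl\<close>)
       (intro sum.cong refl linear_operator_sum[OF T], use x' in \<open>force intro!: carrier_scl\<close>)
  then show ?thesis
    using T x' unfolding mat_sandwich_def linear_operator_def by simp
qed

lemma mat_sandwich_sandwich:
  "mat_sandwich V n A (mat_sandwich V m a x b) B i j
    = mat_sandwich V m (\<lambda>i k. \<Sum>p<n. A i p * a p k) x (\<lambda>l j. \<Sum>r<n. b l r * B r j) i j"
proof -
  have "mat_sandwich V n A (mat_sandwich V m a x b) B i j
      = (\<Sum>p<n. \<Sum>r<n. \<Sum>k<m. \<Sum>l<m. scl V ((A i p * a p k) * (b l r * B r j)) (x k l))"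
    by (simp add: mat_sandwich_def vs.scale_sum_right mult_ac)
  also have "\<dots> = (\<Sum>k<m. \<Sum>l<m. \<Sum>p<n. \<Sum>r<n. scl V ((A i p * a p k) * (b l r * B r j)) (x k l))"
    by (rule sum_swap4)
  finally show ?thesis
    by (simp add: mat_sandwich_def sum_product vs.scale_sum_left)
qed

text \<open>
  Half the sum of the two squares is used in place of the product of the two Hilbert-Schmidt norms,
  because it is additive when factorizations are put side by side.
\<close>
definition gauge_bounds :: "nat \<Rightarrow> (nat \<Rightarrow> nat \<Rightarrow> 'a) \<Rightarrow> real set" where
  "gauge_bounds N u = {(hs_norm_sq N m a + hs_norm_sq m N b) / 2 | m a x b. 0 < m \<and> x \<in> matrices_over V m
     \<and> mnorm V m x \<le> 1 \<and> (\<forall>i<N. \<forall>j<N. u i j = mat_sandwich V m a x b i j)}"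

definition factor_gauge :: "nat \<Rightarrow> (nat \<Rightarrow> nat \<Rightarrow> 'a) \<Rightarrow> real" where
  "factor_gauge N u = Inf (gauge_bounds N u)"

lemma gauge_boundsI:
  assumes "0 < m" "x \<in> matrices_over V m" "mnorm V m x \<le> 1"
    "\<And>i j. i < N \<Longrightarrow> j < N \<Longrightarrow> u i j = mat_sandwich V m a x b i j"
  shows "(hs_norm_sq N m a + hs_norm_sq m N b) / 2 \<in> gauge_bounds N u"
  unfolding gauge_bounds_def using assms by blast

lemma gauge_boundsE:
  assumes "t \<in> gauge_bounds N u"
  obtains m a x b where "t = (hs_norm_sq N m a + hs_norm_sq m N b) / 2" "0 < m" "x \<in> matrices_over V m"
    "mnorm V m x \<le> 1" "\<forall>i<N. \<forall>j<N. u i j = mat_sandwich V m a x b i j"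
  using assms unfolding gauge_bounds_def by blast

lemma hs_norm_sq_nonneg: "0 \<le> hs_norm_sq p q a"
  unfolding hs_norm_sq_def by (intro sum_nonneg) auto

lemma gauge_bounds_nonneg: "t \<in> gauge_bounds N u \<Longrightarrow> 0 \<le> t"
  by (elim gauge_boundsE, hypsubst) (simp add: hs_norm_sq_nonneg)

lemma factor_gauge_le: "t \<in> gauge_bounds N u \<Longrightarrow> factor_gauge N u \<le> t"
  unfolding factor_gauge_def by (intro cInf_lower bdd_belowI[of _ 0]) (auto intro: gauge_bounds_nonneg)

lemma mat_sandwich_diag:
  assumes "i < N" "j < N"
  shows "mat_sandwich V N (\<lambda>i k. if k = i then \<alpha> else 0) u (\<lambda>l j. if l = j then \<beta> else 0) i j
    = scl V (\<alpha> * \<beta>) (u i j)"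
proof -
  have "mat_sandwich V N (\<lambda>i k. if k = i then \<alpha> else 0) u (\<lambda>l j. if l = j then \<beta> else 0) i j
      = (\<Sum>k<N. \<Sum>l<N. if k = i then if l = j then scl V (\<alpha> * \<beta>) (u k l) else 0 else 0)"
    unfolding mat_sandwich_def by (intro sum.cong refl) auto
  also have "\<dots> = (\<Sum>k<N. if k = i then \<Sum>l<N. if l = j then scl V (\<alpha> * \<beta>) (u k l) else 0 else 0)"
    by (intro sum.cong refl) auto
  finally show ?thesis using assms by (simp add: sum.delta)
qed

text \<open>
  The trivial factorization, \<open>u\<close> rescaled into the unit ball between two multiples of the identity.
\<close>
lemma gauge_bounds_nonempty:
  assumes "0 < N" "u \<in> matrices_over V N"
  shows "gauge_bounds N u \<noteq> {}"
proof -
  define t where "t = mnorm V N u + 1"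
  have t: "t > 0" using mnorm_nonneg[OF assms] by (simp add: t_def)
  let ?x = "\<lambda>i j. scl V (of_real (inverse t)) (u i j)"
  have x: "?x \<in> matrices_over V N" using assms(2) by (auto simp: matrices_over_def carrier_scl)
  have "mnorm V N ?x = inverse t * mnorm V N u" using t by (simp add: mnorm_scl assms norm_inverse)
  also have "\<dots> \<le> 1" using t by (simp add: t_def field_simps)
  finally have "(hs_norm_sq N N (\<lambda>i k. if k = i then of_real t else 0) + hs_norm_sq N N (\<lambda>l j. if l = j then 1 else 0)) / 2
      \<in> gauge_bounds N u"
    using t by (intro gauge_boundsI[OF assms(1) x]) (auto simp: mat_sandwich_diag)
  then show ?thesis by blast
qed

lemma le_factor_gaugeI:
  assumes "0 < N" "u \<in> matrices_over V N" "0 \<le> K"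
    and "\<And>t. t \<in> gauge_bounds N u \<Longrightarrow> A \<le> K * t"
  shows "A \<le> K * factor_gauge N u"
proof (cases "K = 0")
  case True
  then show ?thesis using gauge_bounds_nonempty[OF assms(1,2)] assms(4) by auto
next
  case False
  then have "A / K \<le> factor_gauge N u"
    unfolding factor_gauge_def using assms
    by (intro cInf_greatest gauge_bounds_nonempty) (auto simp: field_simps)
  then show ?thesis using False assms(3) by (simp add: field_simps)
qed

text \<open>
  If \<open>u = a x b\<close> and \<open>w = a' x' b'\<close>, then \<open>u + w\<close> is the product of the row
  \<open>(a, a')\<close>, the direct sum of \<open>x\<close> and \<open>x'\<close>, and the column \<open>(b, b')\<close>.  The direct sum stays
  in the unit ball because its norm is the maximum of the two norms.
\<close>
lemma factor_gauge_add:
  assumes N: "0 < N" and u: "u \<in> matrices_over V N" and w: "w \<in> matrices_over V N"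
  shows "factor_gauge N (\<lambda>i j. u i j + w i j) \<le> factor_gauge N u + factor_gauge N w"
proof -
  have *: "factor_gauge N (\<lambda>i j. u i j + w i j) \<le> t + t'"
    if tu: "t \<in> gauge_bounds N u" and tw: "t' \<in> gauge_bounds N w" for t t'
  proof -
    obtain m a x b where t: "t = (hs_norm_sq N m a + hs_norm_sq m N b) / 2" and m: "0 < m"
      and x: "x \<in> matrices_over V m" "mnorm V m x \<le> 1"
      and ux: "\<forall>i<N. \<forall>j<N. u i j = mat_sandwich V m a x b i j"
      using tu by (rule gauge_boundsE) blast
    obtain m' a' x' b' where t': "t' = (hs_norm_sq N m' a' + hs_norm_sq m' N b') / 2" and m': "0 < m'"
      and x': "x' \<in> matrices_over V m'" "mnorm V m' x' \<le> 1"
      and wx': "\<forall>i<N. \<forall>j<N. w i j = mat_sandwich V m' a' x' b' i j"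
      using tw by (rule gauge_boundsE) blast
    let ?a = "\<lambda>i k. if k < m then a i k else a' i (k - m)"
    let ?b = "\<lambda>l j. if l < m then b l j else b' (l - m) j"
    have "mnorm V (m + m') (mat_dsum m x x') \<le> 1"
      using x x' by (simp add: mnorm_dsum[OF m m'])
    moreover have "u i j + w i j = mat_sandwich V (m + m') ?a (mat_dsum m x x') ?b i j"
      if "i < N" "j < N" for i j
      by (simp add: ux wx' that mat_sandwich_def sum_lessThan_add mat_dsum_def)
    ultimately have "(hs_norm_sq N (m + m') ?a + hs_norm_sq (m + m') N ?b) / 2
        \<in> gauge_bounds N (\<lambda>i j. u i j + w i j)"
      using m by (intro gauge_boundsI[OF _ matrices_over_dsum[OF x(1) x'(1)]]) auto
    then have "factor_gauge N (\<lambda>i j. u i j + w i j) \<le> (hs_norm_sq N (m + m') ?a + hs_norm_sq (m + m') N ?b) / 2"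
      by (rule factor_gauge_le)
    also have "hs_norm_sq N (m + m') ?a = hs_norm_sq N m a + hs_norm_sq N m' a'"
      by (simp add: hs_norm_sq_def sum_lessThan_add sum.distrib)
    also have "hs_norm_sq (m + m') N ?b = hs_norm_sq m N b + hs_norm_sq m' N b'"
      by (simp add: hs_norm_sq_def sum_lessThan_add)
    also have "(hs_norm_sq N m a + hs_norm_sq N m' a' + (hs_norm_sq m N b + hs_norm_sq m' N b')) / 2 = t + t'"
      by (simp add: t t' field_simps)
    finally show ?thesis .
  qed
  have "factor_gauge N (\<lambda>i j. u i j + w i j) - t' \<le> 1 * factor_gauge N u" if "t' \<in> gauge_bounds N w" for t'
    using *[OF _ that] by (intro le_factor_gaugeI[OF N u]) (auto simp: algebra_simps)
  then have "factor_gauge N (\<lambda>i j. u i j + w i j) - factor_gauge N u \<le> 1 * factor_gauge N w"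
    by (intro le_factor_gaugeI[OF N w]) (auto simp: algebra_simps)
  then show ?thesis by simp
qed

lemma factor_gauge_scl_le:
  assumes N: "0 < N" and u: "u \<in> matrices_over V N" and c: "0 < c"
  shows "factor_gauge N (\<lambda>i j. scl V (of_real c) (u i j)) \<le> c * factor_gauge N u"
proof (rule le_factor_gaugeI[OF N u])
  fix t assume "t \<in> gauge_bounds N u"
  then obtain m a x b where t: "t = (hs_norm_sq N m a + hs_norm_sq m N b) / 2" and m: "0 < m"
    and x: "x \<in> matrices_over V m" "mnorm V m x \<le> 1"
    and ux: "\<forall>i<N. \<forall>j<N. u i j = mat_sandwich V m a x b i j"
    by (rule gauge_boundsE) blast
  let ?r = "complex_of_real (sqrt c)"
  have r: "?r * ?r = of_real c" using c by (simp flip: of_real_mult)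
  have "scl V (of_real c) (u i j) = mat_sandwich V m (\<lambda>i k. ?r * a i k) x (\<lambda>l j. ?r * b l j) i j"
    if "i < N" "j < N" for i j
    by (simp add: ux that mat_sandwich_def vs.scale_sum_right mult_ac flip: r)
  then have "(hs_norm_sq N m (\<lambda>i k. ?r * a i k) + hs_norm_sq m N (\<lambda>l j. ?r * b l j)) / 2
      \<in> gauge_bounds N (\<lambda>i j. scl V (of_real c) (u i j))"
    by (intro gauge_boundsI[OF m x])
  then have "factor_gauge N (\<lambda>i j. scl V (of_real c) (u i j))
      \<le> (hs_norm_sq N m (\<lambda>i k. ?r * a i k) + hs_norm_sq m N (\<lambda>l j. ?r * b l j)) / 2"
    by (rule factor_gauge_le)
  also have "\<dots> = c * t"
    using c by (simp add: t hs_norm_sq_def norm_mult power_mult_distrib distrib_left flip: sum_distrib_left)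
  finally show "factor_gauge N (\<lambda>i j. scl V (of_real c) (u i j)) \<le> c * t" .
qed (use c in simp)

lemma factor_gauge_scl:
  assumes N: "0 < N" and u: "u \<in> matrices_over V N" and c: "0 < c"
  shows "factor_gauge N (\<lambda>i j. scl V (of_real c) (u i j)) = c * factor_gauge N u"
proof (rule antisym[OF factor_gauge_scl_le[OF assms]])
  let ?u = "\<lambda>i j. scl V (of_real c) (u i j)"
  have "?u \<in> matrices_over V N" using u by (auto simp: matrices_over_def carrier_scl)
  from factor_gauge_scl_le[OF N this, of "inverse c"] c
  have "factor_gauge N u \<le> inverse c * factor_gauge N ?u" by simp
  then show "c * factor_gauge N u \<le> factor_gauge N ?u" using c by (simp add: field_simps)
qed

end

section \<open>Extension of matrix-valued maps\<close>

lemma mult_le_half_squares: "0 \<le> C \<Longrightarrow> x * (C * y) \<le> C * ((x\<^sup>2 + y\<^sup>2) / 2)" for x y C :: real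
proof -
  assume C: "0 \<le> C"
  have "x * y \<le> (x\<^sup>2 + y\<^sup>2) / 2"
    using zero_le_power2[of "x - y"] by (simp add: power2_diff)
  from mult_left_mono[OF this C] show ?thesis by (simp add: mult_ac)
qed

context matrix_normed_space
begin

text \<open>
  The factorization \<open>u = a x b\<close> uses an \<open>x\<close> with entries in the large space, where \<open>T\<close> is not
  defined.  Writing \<open>a = L q\<close>, \<open>q = M a\<close> and likewise for the transpose of \<open>b\<close>, the
  compression \<open>y\<close> of \<open>x\<close> by the two contractions satisfies \<open>u = L y L'\<close>, up to transposition of
  \<open>L'\<close>, and its entries are combinations of entries of \<open>u\<close>.  So \<open>y\<close> is a matrix over \<open>X\<close> in
  the unit ball, to which the bound for \<open>T\<close> applies.
\<close>
lemma trace_pairing_le_gauge_bound: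
  fixes T :: "'a \<Rightarrow> complex^'n^'n"
  assumes X: "vs.subspace X" "X \<subseteq> space_carrier V"
    and T: "cb_norm_le (restrict_space_to V X) Mn C T" and C: "0 \<le> C"
    and e: "bij_betw e {..<N} UNIV" and N: "0 < N"
    and u: "u \<in> matrices_over (restrict_space_to V X) N" and t: "t \<in> gauge_bounds N u"
  shows "Re (\<Sum>i<N. \<Sum>j<N. T (u i j) $ e i $ e j) \<le> C * t"
proof -
  interpret VX: matrix_normed_space "restrict_space_to V X"
    by (rule restrict_matrix_normed_space[OF X])
  obtain m a x b where t: "t = (hs_norm_sq N m a + hs_norm_sq m N b) / 2" and m: "0 < m"
    and x: "x \<in> matrices_over V m" "mnorm V m x \<le> 1"
    and ux: "\<forall>i<N. \<forall>j<N. u i j = mat_sandwich V m a x b i j"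
    using t by (rule gauge_boundsE) blast
  obtain L q M where aL: "\<forall>i<N. \<forall>k<m. a i k = (\<Sum>p<N. L i p * q p k)"
    and qM: "\<forall>i<N. \<forall>k<m. q i k = (\<Sum>p<N. M i p * a p k)"
    and q: "scalar_mat_norm N m q \<le> 1" and L: "hs_norm_sq N N L = hs_norm_sq N m a"
    using orthonormal_row_factorization[of N m a] by (elim exE conjE)
  obtain L' q' M' where bL: "\<forall>j<N. \<forall>l<m. b l j = (\<Sum>p<N. L' j p * q' p l)"
    and qM': "\<forall>j<N. \<forall>l<m. q' j l = (\<Sum>p<N. M' j p * b l p)"
    and q': "scalar_mat_norm m N (\<lambda>l j. q' j l) \<le> 1" and L': "hs_norm_sq N N L' = hs_norm_sq N m (\<lambda>j l. b l j)"
    using orthonormal_row_factorization[of N m "\<lambda>j l. b l j"] by (elim exE conjE)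
  define y where "y = mat_sandwich V m q x (\<lambda>l j. q' j l)"
  have "mnorm V N y \<le> scalar_mat_norm N m q * mnorm V m x * scalar_mat_norm m N (\<lambda>l j. q' j l)"
    unfolding y_def by (rule mnorm_sandwich[OF m N x(1)])
  also have "\<dots> \<le> 1 * 1 * 1"
    by (intro mult_mono q q' x(2) scalar_mat_norm_nonneg mnorm_nonneg m x(1) mult_nonneg_nonneg) auto
  finally have y1: "mnorm V N y \<le> 1" by simp
  have yu: "y i j = mat_sandwich V N M u (\<lambda>l j. M' j l) i j" if "i < N" "j < N" for i j
  proof -
    have "mat_sandwich V N M u (\<lambda>l j. M' j l) i j
        = mat_sandwich V N M (mat_sandwich V m a x b) (\<lambda>l j. M' j l) i j"
      by (rule mat_sandwich_cong) (auto simp: ux)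
    also have "\<dots> = y i j"
      unfolding y_def mat_sandwich_sandwich
      by (rule mat_sandwich_cong) (use that in \<open>auto simp: qM qM' mult.commute\<close>)
    finally show ?thesis by simp
  qed
  have yX: "y \<in> matrices_over (restrict_space_to V X) N"
    using VX.matrices_over_sandwich[OF u, of M "\<lambda>l j. M' j l" N]
    by (auto simp: matrices_over_def yu mat_sandwich_def)
  have uy: "u i j = mat_sandwich (restrict_space_to V X) N L y (\<lambda>l j. L' j l) i j"
    if "i < N" "j < N" for i j
  proof -
    have "u i j = mat_sandwich V m a x b i j" using ux that by blast
    also have "\<dots> = mat_sandwich V N L y (\<lambda>l j. L' j l) i j"
      unfolding y_def mat_sandwich_sandwich
      by (rule mat_sandwich_cong) (use that in \<open>auto simp: aL bL mult.commute\<close>)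
    finally show ?thesis by (simp add: mat_sandwich_def)
  qed
  define e' where "e' = inv_into {..<N} e"
  have e': "bij_betw e' UNIV {..<N}" unfolding e'_def by (rule bij_betw_inv_into[OF e])
  have e'e: "e' (e i) = i" if "i < N" for i
    unfolding e'_def using e that by (intro inv_into_f_f) (auto simp: bij_betw_def)
  define \<xi> :: "nat \<Rightarrow> complex^'n" where "\<xi> k = (\<chi> r. cnj (L (e' r) k))" for k
  define v :: "nat \<Rightarrow> complex^'n" where "v l = (\<chi> s. L' (e' s) l)" for l
  have l2_hs: "(l2 N w)\<^sup>2 = hs_norm_sq N N K"
    if "\<And>k r. cmod (w k $ r) = cmod (K (e' r) k)" for w :: "nat \<Rightarrow> complex^'n" and K
  proof -
    have "(l2 N w)\<^sup>2 = (\<Sum>k<N. \<Sum>r\<in>UNIV. (cmod (K (e' r) k))\<^sup>2)"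
      by (simp add: l2_square norm_vec_def L2_set_def sum_nonneg that)
    also have "\<dots> = (\<Sum>k<N. \<Sum>i<N. (cmod (K i k))\<^sup>2)"
      by (intro sum.cong refl sum.reindex_bij_betw[OF e'])
    also have "\<dots> = hs_norm_sq N N K" unfolding hs_norm_sq_def by (rule sum.swap)
    finally show ?thesis .
  qed
  have "(\<Sum>i<N. \<Sum>j<N. T (u i j) $ e i $ e j)
      = (\<Sum>i<N. \<Sum>j<N. mat_sandwich Mn N (\<lambda>i k. cnj (\<xi> k $ e i)) (\<lambda>k l. T (y k l)) (\<lambda>l j. v l $ e j) i j
          $ e i $ e j)"
  proof (intro sum.cong refl)
    fix i j assume "i \<in> {..<N}" "j \<in> {..<N}"
    then have ij: "i < N" "j < N" by auto
    have "T (u i j) = mat_sandwich Mn N L (\<lambda>k l. T (y k l)) (\<lambda>l j. L' j l) i j"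
      unfolding uy[OF ij] by (rule VX.linear_operator_sandwich[OF cb_norm_le_linear[OF T] yX])
    also have "\<dots> = mat_sandwich Mn N (\<lambda>i k. cnj (\<xi> k $ e i)) (\<lambda>k l. T (y k l)) (\<lambda>l j. v l $ e j) i j"
      by (rule mat_sandwich_cong) (simp_all add: \<xi>_def v_def e'e ij)
    finally show "T (u i j) $ e i $ e j = mat_sandwich Mn N (\<lambda>i k. cnj (\<xi> k $ e i))
        (\<lambda>k l. T (y k l)) (\<lambda>l j. v l $ e j) i j $ e i $ e j" by simp
  qed
  then have "Re (\<Sum>i<N. \<Sum>j<N. T (u i j) $ e i $ e j)
      = (\<Sum>k<N. inner (\<xi> k) (\<Sum>l<N. T (y k l) *v v l))"
    by (simp only: pairing_eq_sandwich[OF e])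
  also have "\<dots> \<le> l2 N \<xi> * l2 N (\<lambda>k. \<Sum>l<N. T (y k l) *v v l)" by (rule sum_inner_le_l2)
  also have "\<dots> \<le> l2 N \<xi> * (C * l2 N v)"
  proof (rule mult_left_mono)
    have "mnorm Mn N (\<lambda>i j. T (y i j)) \<le> C" using y1 by (intro cb_norm_leD[OF T N yX]) simp
    then show "l2 N (\<lambda>k. \<Sum>l<N. T (y k l) *v v l) \<le> C * l2 N v"
      by (intro order_trans[OF Mn_apply_le] mult_right_mono) auto
  qed simp
  also have "\<dots> \<le> C * (((l2 N \<xi>)\<^sup>2 + (l2 N v)\<^sup>2) / 2)" by (rule mult_le_half_squares[OF C])
  also have "(l2 N \<xi>)\<^sup>2 = hs_norm_sq N m a" unfolding L[symmetric] by (rule l2_hs) (simp add: \<xi>_def)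
  also have "(l2 N v)\<^sup>2 = hs_norm_sq N m (\<lambda>j l. b l j)" unfolding L'[symmetric] by (rule l2_hs) (simp add: v_def)
  also have "hs_norm_sq N m (\<lambda>j l. b l j) = hs_norm_sq m N b" unfolding hs_norm_sq_def by (rule sum.swap)
  finally show ?thesis unfolding t .
qed

definition single_entry :: "nat \<Rightarrow> nat \<Rightarrow> 'a \<Rightarrow> nat \<Rightarrow> nat \<Rightarrow> 'a" where
  "single_entry i0 j0 y = (\<lambda>i j. if i = i0 \<and> j = j0 then y else 0)"

text \<open>
  The functional belonging to \<open>T\<close> is extended by the Hahn-Banach theorem as a real functional
  \<open>g\<close>.  The values of \<open>g\<close> at matrices with a single nonzero entry are the real parts of the
  matrix entries of the extension \<open>R\<close>; complex linearity dictates the imaginary parts.  The bound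
  for \<open>R\<close> is the domination of \<open>g\<close> by the gauge, read through \<open>pairing_eq_sandwich\<close>.
\<close>
theorem Wittstock_extension:
  fixes T :: "'a \<Rightarrow> complex^'n^'n"
  assumes X: "vs.subspace X" "X \<subseteq> space_carrier V"
    and T: "cb_norm_le (restrict_space_to V X) Mn C T" and C: "0 \<le> C"
  shows "\<exists>S. cb_norm_le V Mn C S \<and> (\<forall>x\<in>X. S x = T x)"
proof -
  interpret VX: matrix_normed_space "restrict_space_to V X"
    by (rule restrict_matrix_normed_space[OF X])
  note Tlin = cb_norm_le_linear[OF T]
  have T_add: "T (x + y) = T x + T y" if "x \<in> X" "y \<in> X" for x y
    using Tlin that by (simp add: linear_operator_def)
  have T_scl: "T (scl V c x) = scl Mn c (T x)" if "x \<in> X" for c x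
    using Tlin that by (simp add: linear_operator_def)
  have T0: "T 0 = 0" by (rule VX.linear_operator_0[OF Tlin])
  define N where "N = CARD('n)"
  have N: "0 < N" by (simp add: N_def)
  obtain e :: "nat \<Rightarrow> 'n" where e: "bij_betw e {..<N} UNIV"
    using ex_bij_betw_nat_finite[of "UNIV :: 'n set"] by (auto simp: N_def atLeast0LessThan)
  define e' where "e' = inv_into {..<N} e"
  have e'e: "e' (e i) = i" if "i < N" for i
    unfolding e'_def using e that by (intro inv_into_f_f) (auto simp: bij_betw_def)
  have ee': "e (e' r) = r" and e'N: "e' r < N" for r
    unfolding e'_def using e bij_betw_imp_surj_on[OF e] f_inv_into_f[of r e "{..<N}"]
      inv_into_into[of r e "{..<N}"] by auto
  let ?W = "matrices_over V N" and ?S = "matrices_over (restrict_space_to V X) N"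
  let ?s = "\<lambda>c u i j. scl V (complex_of_real c) (u i j)"
  let ?F = "\<lambda>u. Re (\<Sum>i<N. \<Sum>j<N. T (u i j) $ e i $ e j)"
  have vs: "vector_space ?s"
    by unfold_locales
      (simp_all add: fun_eq_iff vs.scale_right_distrib vs.scale_left_distrib)
  then interpret M: vector_space ?s .
  have W: "M.subspace ?W"
    by (rule M.subspaceI) (auto simp: matrices_over_def carrier_0 carrier_add carrier_scl)
  have S: "M.subspace ?S"
    using VX.carrier_0 VX.carrier_add VX.carrier_scl
    by (intro M.subspaceI) (auto simp: matrices_over_def)
  have SW: "?S \<subseteq> ?W" using X(2) by (auto simp: matrices_over_def)
  have "\<exists>g. (\<forall>x\<in>?W. \<forall>y\<in>?W. g (x + y) = g x + g y) \<and> (\<forall>c. \<forall>x\<in>?W. g (?s c x) = c * g x)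
      \<and> (\<forall>x\<in>?S. g x = ?F x) \<and> (\<forall>x\<in>?W. g x \<le> C * factor_gauge N x)"
  proof (rule Hahn_Banach[OF vs W S SW])
    fix x y assume "x \<in> ?W" "y \<in> ?W"
    then have "factor_gauge N (\<lambda>i j. x i j + y i j) \<le> factor_gauge N x + factor_gauge N y"
      by (rule factor_gauge_add[OF N])
    then show "C * factor_gauge N (x + y) \<le> C * factor_gauge N x + C * factor_gauge N y"
      using mult_left_mono[OF _ C] by (fastforce simp: plus_fun_def distrib_left)
  next
    fix c :: real and x assume "0 < c" "x \<in> ?W"
    then show "C * factor_gauge N (?s c x) = c * (C * factor_gauge N x)"
      by (simp add: factor_gauge_scl[OF N])
  next
    fix x y assume "x \<in> ?S" "y \<in> ?S"
    then show "?F (x + y) = ?F x + ?F y"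
      by (simp add: matrices_over_def T_add sum.distrib)
  next
    fix c x assume "x \<in> ?S"
    then show "?F (?s c x) = c * ?F x"
      by (simp add: matrices_over_def T_scl sum_distrib_left)
  next
    fix x assume x: "x \<in> ?S"
    show "?F x \<le> C * factor_gauge N x"
      using x SW by (intro le_factor_gaugeI[OF N _ C] trace_pairing_le_gauge_bound[OF X T C e N]) auto
  qed
  then obtain g where g_add: "\<And>x y. x \<in> ?W \<Longrightarrow> y \<in> ?W \<Longrightarrow> g (x + y) = g x + g y"
    and g_scale: "\<And>c x. x \<in> ?W \<Longrightarrow> g (?s c x) = c * g x"
    and g_F: "\<And>x. x \<in> ?S \<Longrightarrow> g x = ?F x"
    and g_le: "\<And>x. x \<in> ?W \<Longrightarrow> g x \<le> C * factor_gauge N x" by blast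
  have g0: "g 0 = 0" using g_scale[of 0 0] by (simp add: matrices_over_def carrier_0 zero_fun_def)
  have g_sum: "g (\<Sum>i\<in>I. f i) = (\<Sum>i\<in>I. g (f i))" if "\<And>i. i \<in> I \<Longrightarrow> f i \<in> ?W" for I :: "nat set" and f
    using that
  proof (induction I rule: infinite_finite_induct)
    case (insert i I)
    have "(\<Sum>i\<in>I. f i) \<in> ?W" using insert.prems by (intro M.subspace_sum[OF W]) auto
    then have "g (f i + (\<Sum>i\<in>I. f i)) = g (f i) + g (\<Sum>i\<in>I. f i)"
      using insert.prems by (intro g_add) auto
    moreover have "g (\<Sum>i\<in>I. f i) = (\<Sum>i\<in>I. g (f i))"
      by (rule insert.IH) (rule insert.prems, simp)
    ultimately show ?case by (simp only: sum.insert[OF insert.hyps])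
  qed (simp_all add: g0)
  have uW: "single_entry i j y \<in> ?W" if "y \<in> space_carrier V" for i j y
    using that by (simp add: matrices_over_def single_entry_def carrier_0)
  define h where "h r s y = g (single_entry (e' r) (e' s) y)" for r s y
  have h_add: "h r s (x + y) = h r s x + h r s y"
    if "x \<in> space_carrier V" "y \<in> space_carrier V" for r s x y
  proof -
    have "single_entry i j (x + y) = single_entry i j x + single_entry i j y" for i j
      by (simp add: single_entry_def fun_eq_iff)
    then show ?thesis using that by (simp add: h_def g_add uW)
  qed
  have h_scale: "h r s (scl V (of_real c) x) = c * h r s x" if "x \<in> space_carrier V" for r s c x
  proof -
    have "single_entry i j (scl V (of_real c) x) = ?s c (single_entry i j x)" for i j
      by (simp add: single_entry_def fun_eq_iff)
    then show ?thesis using that by (simp add: h_def g_scale uW)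
  qed
  have h_scl: "h r s (scl V c x) = Re c * h r s x + Im c * h r s (scl V \<i> x)"
    if x: "x \<in> space_carrier V" for r s c x
  proof -
    have "scl V c x = scl V (of_real (Re c)) x + scl V (of_real (Im c)) (scl V \<i> x)"
      by (simp add: complex_eq_iff flip: vs.scale_left_distrib)
    then show ?thesis using x by (simp add: h_add h_scale carrier_scl del: vs.scale_scale)
  qed
  define R where "R y = (\<chi> r s. Complex (h r s y) (- h r s (scl V \<i> y)))" for y
  have R_lin: "linear_operator V Mn R"
    unfolding linear_operator_def
  proof (intro conjI ballI allI)
    fix x y assume "x \<in> space_carrier V" "y \<in> space_carrier V"
    then show "R (x + y) = R x + R y"
      by (simp add: R_def vec_eq_iff complex_eq_iff vs.scale_right_distrib h_add carrier_scl)
  next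
    fix c x assume x: "x \<in> space_carrier V"
    have h1: "h r s (scl V c x) = Re c * h r s x + Im c * h r s (scl V \<i> x)" for r s
      by (rule h_scl[OF x])
    have h2: "h r s (scl V \<i> (scl V c x)) = Re c * h r s (scl V \<i> x) - Im c * h r s x" for r s
      unfolding vs.scale_scale h_scl[OF x, of r s "\<i> * c"] by simp
    show "R (scl V c x) = scl Mn c (R x)"
      by (simp add: R_def vec_eq_iff complex_eq_iff h1 h2 del: vs.scale_scale)
  qed simp
  have R_T: "R x = T x" if x: "x \<in> X" for x
  proof -
    have hT: "h r s y = Re (T y $ r $ s)" if y: "y \<in> X" for r s y
    proof -
      have "single_entry (e' r) (e' s) y \<in> ?S"
        using y VX.carrier_0 by (simp add: matrices_over_def single_entry_def)
      then have "h r s y = ?F (single_entry (e' r) (e' s) y)" unfolding h_def by (rule g_F)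
      also have "(\<Sum>i<N. \<Sum>j<N. T (single_entry (e' r) (e' s) y i j) $ e i $ e j)
          = (\<Sum>i<N. \<Sum>j<N. if i = e' r then if j = e' s then T y $ e i $ e j else 0 else 0)"
        by (intro sum.cong refl) (simp add: single_entry_def T0)
      also have "\<dots> = (\<Sum>i<N. if i = e' r then \<Sum>j<N. if j = e' s then T y $ e i $ e j else 0 else 0)"
        by (intro sum.cong refl) auto
      also have "\<dots> = T y $ r $ s" by (simp add: sum.delta e'N ee')
      finally show ?thesis .
    qed
    have "scl V \<i> x \<in> X" using VX.carrier_scl[of x \<i>] x by simp
    then show ?thesis using x by (simp add: R_def vec_eq_iff complex_eq_iff hT T_scl)
  qed
  have "mnorm Mn m (\<lambda>i j. R (x i j)) \<le> C"
    if m: "0 < m" and x: "x \<in> matrices_over V m" "mnorm V m x \<le> 1" for m x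
  proof (rule Mn_mnorm_leI)
    fix v :: "nat \<Rightarrow> complex^'n" assume v: "l2 m v \<le> 1"
    show "l2 m (\<lambda>i. \<Sum>j<m. R (x i j) *v v j) \<le> C"
    proof (rule l2_leI_inner[OF C])
      fix \<xi> :: "nat \<Rightarrow> complex^'n" assume \<xi>: "l2 m \<xi> \<le> 1"
      let ?a = "\<lambda>i k. cnj (\<xi> k $ e i)" and ?b = "\<lambda>l j. v l $ e j"
      \<comment> \<open>\<open>g\<close> sees the entries outside of the \<open>N\<close>-by-\<open>N\<close> block, so \<open>u\<close> is replaced by the
        matrix \<open>u'\<close> that vanishes there\<close>
      define u where "u = mat_sandwich V m ?a x ?b"
      have u: "u i j \<in> space_carrier V" if "i < N" "j < N" for i j
        using matrices_over_sandwich[OF x(1), of ?a ?b N] that by (simp add: u_def matrices_over_def)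
      define u' where "u' = (\<Sum>i<N. \<Sum>j<N. single_entry i j (u i j))"
      have u'u: "u' i j = u i j" if "i < N" "j < N" for i j
      proof -
        have "u' i j = (\<Sum>k<N. \<Sum>l<N. if i = k then if j = l then u k l else 0 else 0)"
          by (simp add: u'_def sum_fun_apply single_entry_def) (intro sum.cong refl, auto)
        also have "\<dots> = (\<Sum>k<N. if i = k then \<Sum>l<N. if j = l then u k l else 0 else 0)"
          by (intro sum.cong refl) auto
        finally show ?thesis using that by (simp add: sum.delta')
      qed
      have hs: "hs_norm_sq N m ?a = (l2 m \<xi>)\<^sup>2" "hs_norm_sq m N ?b = (l2 m v)\<^sup>2"
      proof -
        have *: "(norm w)\<^sup>2 = (\<Sum>i<N. (cmod (w $ e i))\<^sup>2)" for w :: "complex^'n"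
          using sum.reindex_bij_betw[OF e, of "\<lambda>r. (cmod (w $ r))\<^sup>2"]
          by (simp add: norm_vec_def L2_set_def sum_nonneg)
        show "hs_norm_sq N m ?a = (l2 m \<xi>)\<^sup>2" unfolding hs_norm_sq_def l2_square * by (subst sum.swap) simp
        show "hs_norm_sq m N ?b = (l2 m v)\<^sup>2" unfolding hs_norm_sq_def l2_square * ..
      qed
      have u'W: "u' \<in> ?W" using u u'u by (simp add: matrices_over_def)
      have "factor_gauge N u' \<le> (hs_norm_sq N m ?a + hs_norm_sq m N ?b) / 2"
        by (intro factor_gauge_le gauge_boundsI[OF m x]) (simp add: u'u, simp add: u_def)
      also have "\<dots> \<le> 1"
        unfolding hs using \<xi> v power_le_one[of "l2 m \<xi>" 2] power_le_one[of "l2 m v" 2] by simp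
      finally have "C * factor_gauge N u' \<le> C" using C by (intro mult_left_le)
      then have gu': "g u' \<le> C" using g_le[OF u'W] by linarith
      have "(\<Sum>k<m. inner (\<xi> k) (\<Sum>l<m. R (x k l) *v v l))
          = Re (\<Sum>i<N. \<Sum>j<N. R (u i j) $ e i $ e j)"
        unfolding pairing_eq_sandwich[OF e] u_def linear_operator_sandwich[OF R_lin x(1)] ..
      also have "\<dots> = (\<Sum>i<N. \<Sum>j<N. g (single_entry i j (u i j)))"
        by (simp add: R_def h_def e'e)
      also have "\<dots> = g u'"
        unfolding u'_def using u
        by (subst g_sum, force intro!: M.subspace_sum[OF W] uW) (auto intro!: sum.cong g_sum[symmetric] uW)
      also have "\<dots> \<le> C" by (rule gu')
      finally show "(\<Sum>k<m. inner (\<xi> k) (\<Sum>l<m. R (x k l) *v v l)) \<le> C" .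
    qed
  qed
  then have "cb_norm_le V Mn C R" using R_lin unfolding cb_norm_le_def by blast
  then show ?thesis using R_T by blast
qed

end

section \<open>Pointwise compactness and null sequences of extensions\<close>

lemma tendsto_mat_vec:
  fixes A :: "'i \<Rightarrow> complex^'n^'n"
  assumes "(A \<longlongrightarrow> B) F"
  shows "((\<lambda>k. A k *v w) \<longlongrightarrow> B *v w) F"
  unfolding matrix_vector_mult_def
  by (intro vec_tendstoI) (simp, intro tendsto_intros assms)

lemma tendsto_scl_Mn:
  fixes A :: "'i \<Rightarrow> complex^'n^'n"
  assumes "(A \<longlongrightarrow> B) F"
  shows "((\<lambda>k. scl Mn c (A k)) \<longlongrightarrow> scl Mn c B) F"
  by (intro vec_tendstoI) (simp, intro tendsto_intros assms)

lemma norm_le_card_entries: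
  fixes A :: "complex^'n^'n"
  assumes "\<And>r s. cmod (A $ r $ s) \<le> K"
  shows "norm A \<le> (real CARD('n))\<^sup>2 * K"
proof -
  have "norm A \<le> (\<Sum>r\<in>UNIV. norm (A $ r))"
    unfolding norm_vec_def[of A] by (rule L2_set_le_sum) simp
  also have "\<dots> \<le> (\<Sum>r\<in>(UNIV :: 'n set). \<Sum>s\<in>(UNIV :: 'n set). K)"
  proof (rule sum_mono)
    fix r
    have "norm (A $ r) \<le> (\<Sum>s\<in>UNIV. cmod (A $ r $ s))"
      unfolding norm_vec_def[of "A $ r"] by (rule L2_set_le_sum) simp
    also have "\<dots> \<le> (\<Sum>s\<in>(UNIV :: 'n set). K)" by (intro sum_mono assms)
    finally show "norm (A $ r) \<le> (\<Sum>s\<in>(UNIV :: 'n set). K)" .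
  qed
  finally show ?thesis by (simp add: power2_eq_square mult.assoc)
qed

context matrix_normed_space
begin

lemma cb_norm_le_vnorm:
  fixes S :: "'a \<Rightarrow> complex^'n^'n"
  assumes S: "cb_norm_le V Mn C S" and y: "y \<in> space_carrier V"
  shows "vnorm Mn (S y) \<le> C * vnorm V y"
proof (cases "vnorm V y = 0")
  case True
  interpret Mn: matrix_normed_space "Mn :: (complex^'n^'n) op_space" by (rule matrix_normed_space_Mn)
  have "S y = 0" using True y linear_operator_0[OF cb_norm_le_linear[OF S]] by (simp add: vnorm_eq_0_iff)
  then show ?thesis using True by (simp add: Mn.vnorm_0)
next
  case False
  interpret Mn: matrix_normed_space "Mn :: (complex^'n^'n) op_space" by (rule matrix_normed_space_Mn)
  have pos: "vnorm V y > 0" using False vnorm_nonneg[OF y] by simp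
  let ?c = "complex_of_real (inverse (vnorm V y))"
  have cy: "scl V ?c y \<in> space_carrier V" using y by (rule carrier_scl)
  have "vnorm V (scl V ?c y) = 1" using pos by (simp add: vnorm_scl y norm_inverse)
  then have "mnorm V 1 (\<lambda>i j. scl V ?c y) \<le> 1" by (simp add: vnorm_def)
  then have "vnorm Mn (S (scl V ?c y)) \<le> C"
    unfolding vnorm_def[of Mn] using cy by (intro cb_norm_leD[OF S]) (auto simp: matrices_over_def)
  moreover have "S (scl V ?c y) = scl Mn ?c (S y)"
    using cb_norm_le_linear[OF S] y by (simp add: linear_operator_def)
  moreover have "vnorm Mn (scl Mn ?c (S y)) = inverse (vnorm V y) * vnorm Mn (S y)"
    using pos Mn.vnorm_scl[of "S y" ?c] by (simp add: norm_inverse)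
  ultimately have "inverse (vnorm V y) * vnorm Mn (S y) \<le> C" by simp
  then show ?thesis using pos by (simp add: field_simps)
qed

lemma cb_norm_le_norm:
  fixes S :: "'a \<Rightarrow> complex^'n^'n"
  assumes S: "cb_norm_le V Mn C S" and y: "y \<in> space_carrier V"
  shows "norm (S y) \<le> (real CARD('n))\<^sup>2 * (C * vnorm V y)"
proof (rule norm_le_card_entries)
  fix r s
  have "cmod (S y $ r $ s) \<le> vnorm Mn (S y)"
    unfolding vnorm_def by (rule entry_le_Mn_mnorm[where i = 0 and j = 0 and A = "\<lambda>_ _. S y"]) auto
  then show "cmod (S y $ r $ s) \<le> C * vnorm V y" using cb_norm_le_vnorm[OF assms] by linarith
qed

lemma cb_norm_le_diff:
  fixes S :: "'a \<Rightarrow> complex^'n^'n"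
  assumes "cb_norm_le V Mn C S" "x \<in> space_carrier V" "y \<in> space_carrier V"
  shows "S (x - y) = S x - S y"
proof -
  have "S x = S (x - y) + S y"
    using cb_norm_le_linear[OF assms(1)] assms(2,3) carrier_diff[OF assms(2,3)]
    unfolding linear_operator_def by (metis diff_add_cancel)
  then show ?thesis by simp
qed

text \<open>
  Linearity and the bound are conditions on finitely many values at a time, closed under limits.
\<close>
lemma cb_norm_le_pointwise_limit:
  fixes S :: "'i \<Rightarrow> 'a \<Rightarrow> complex^'n^'n"
  assumes F: "F \<noteq> bot" and S: "\<And>k. cb_norm_le V Mn C (S k)"
    and lim: "\<And>y. y \<in> space_carrier V \<Longrightarrow> ((\<lambda>k. S k y) \<longlongrightarrow> R y) F"
  shows "cb_norm_le V Mn C R"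
  unfolding cb_norm_le_def linear_operator_def
proof (intro conjI ballI allI impI)
  fix x y assume x: "x \<in> space_carrier V" and y: "y \<in> space_carrier V"
  have "((\<lambda>k. S k (x + y)) \<longlongrightarrow> R x + R y) F"
    using tendsto_add[OF lim[OF x] lim[OF y]] cb_norm_le_linear[OF S] x y by (simp add: linear_operator_def)
  then show "R (x + y) = R x + R y"
    by (rule tendsto_unique[OF F lim[OF carrier_add[OF x y]]])
next
  fix c x assume x: "x \<in> space_carrier V"
  have "((\<lambda>k. S k (scl V c x)) \<longlongrightarrow> scl Mn c (R x)) F"
    using tendsto_scl_Mn[OF lim[OF x]] cb_norm_le_linear[OF S] x by (simp add: linear_operator_def)
  then show "R (scl V c x) = scl Mn c (R x)"
    by (rule tendsto_unique[OF F lim[OF carrier_scl[OF x]]])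
next
  fix m x assume m: "0 < m" and x: "x \<in> matrices_over V m" "mnorm V m x \<le> 1"
  show "mnorm Mn m (\<lambda>i j. R (x i j)) \<le> C"
  proof (rule Mn_mnorm_leI)
    fix v :: "nat \<Rightarrow> complex^'n" assume v: "l2 m v \<le> 1"
    have "((\<lambda>k. l2 m (\<lambda>i. \<Sum>j<m. S k (x i j) *v v j)) \<longlongrightarrow> l2 m (\<lambda>i. \<Sum>j<m. R (x i j) *v v j)) F"
      unfolding L2_set_def using x(1)
      by (intro tendsto_real_sqrt tendsto_sum tendsto_power tendsto_norm tendsto_mat_vec lim)
         (auto simp: matrices_over_def)
    moreover have "l2 m (\<lambda>i. \<Sum>j<m. S k (x i j) *v v j) \<le> C" for k
    proof -
      have "l2 m (\<lambda>i. \<Sum>j<m. S k (x i j) *v v j) \<le> mnorm Mn m (\<lambda>i j. S k (x i j)) * l2 m v"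
        by (rule Mn_apply_le)
      also have "\<dots> \<le> mnorm Mn m (\<lambda>i j. S k (x i j))" using v by (intro mult_left_le Mn_mnorm_nonneg)
      also have "\<dots> \<le> C" by (rule cb_norm_leD[OF S m x])
      finally show ?thesis .
    qed
    ultimately show "l2 m (\<lambda>i. \<Sum>j<m. R (x i j) *v v j) \<le> C"
      using F by (intro tendsto_upperbound) auto
  qed
qed simp

text \<open>
  Tychonoff's theorem: the values at \<open>y\<close> stay in a closed ball of the finite-dimensional space
  \<open>M\<^sub>n\<close>, with a radius \<open>b y\<close> that depends only on the norm of \<open>y\<close>.
\<close>
lemma cb_norm_le_cluster_point:
  fixes S :: "'i \<Rightarrow> 'a \<Rightarrow> complex^'n^'n"
  assumes F: "F \<noteq> bot" and S: "\<And>k. cb_norm_le V Mn C (S k)"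
  shows "\<exists>R G. G \<noteq> bot \<and> G \<le> F \<and> cb_norm_le V Mn C R
    \<and> (\<forall>y\<in>space_carrier V. ((\<lambda>k. S k y) \<longlongrightarrow> R y) G)"
proof -
  \<comment> \<open>cut off to 0 outside of the carrier, where the maps need not be bounded\<close>
  define S' where "S' k y = (if y \<in> space_carrier V then S k y else 0)" for k y
  define b where "b y = (if y \<in> space_carrier V then (real CARD('n))\<^sup>2 * (C * vnorm V y) else 0)" for y
  let ?K = "PiE UNIV (\<lambda>y. cball (0 :: complex^'n^'n) (b y))"
  have "compactin (product_topology (\<lambda>_. euclidean) UNIV) ?K"
    by (simp add: compactin_PiE)
  then have "compact ?K" by (simp add: euclidean_product_topology)
  have S'K: "S' k \<in> ?K" for k
    using cb_norm_le_norm[OF S] by (auto simp: S'_def b_def)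
  have "filtermap S' F \<noteq> bot" using F by (simp add: filtermap_bot_iff)
  moreover have "eventually (\<lambda>f. f \<in> ?K) (filtermap S' F)"
    using S'K by (simp add: eventually_filtermap)
  ultimately obtain R where R: "inf (nhds R) (filtermap S' F) \<noteq> bot"
    using \<open>compact ?K\<close> unfolding compact_filter by blast
  define G where "G = inf F (filtercomap S' (nhds R))"
  have "G \<noteq> bot"
  proof
    assume "G = bot"
    then have "eventually (\<lambda>_. False) G" by simp
    then obtain P Q where P: "eventually P F" and Q: "eventually Q (filtercomap S' (nhds R))"
      and PQ: "\<And>k. P k \<Longrightarrow> Q k \<Longrightarrow> False"
      unfolding G_def eventually_inf by blast
    from Q obtain Q' where Q': "eventually Q' (nhds R)" and QQ': "\<And>k. Q' (S' k) \<Longrightarrow> Q k"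
      unfolding eventually_filtercomap by blast
    have "eventually (\<lambda>f. \<not> Q' f) (filtermap S' F)"
      unfolding eventually_filtermap using P by (rule eventually_mono) (use PQ QQ' in blast)
    with Q' have "eventually (\<lambda>_. False) (inf (nhds R) (filtermap S' F))"
      unfolding eventually_inf by blast
    then show False using R by (simp add: eventually_False)
  qed
  have "filterlim S' (nhds R) G"
    unfolding G_def by (rule filterlim_mono[OF filterlim_filtercomap order_refl inf_le2])
  then have lim': "((\<lambda>k. S' k y) \<longlongrightarrow> R y) G" for y
    using continuous_on_tendsto_compose[OF continuous_on_product_coordinates[of y], of S' R G] by simp
  have lim: "((\<lambda>k. S k y) \<longlongrightarrow> R y) G" if "y \<in> space_carrier V" for y
    using lim'[of y] that by (simp add: S'_def)
  have "cb_norm_le V Mn C R" by (rule cb_norm_le_pointwise_limit[OF \<open>G \<noteq> bot\<close> S lim])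
  then show ?thesis using \<open>G \<noteq> bot\<close> lim unfolding G_def by (metis inf_le1)
qed

text \<open>
  Veech's argument.  If infinitely many \<open>S k\<close> stayed away, on finitely many points of the dense
  sequence, from all maps in \<open>K0\<close>, the set of maps with bound \<open>C\<close> that vanish on \<open>X\<close>, then
  a cluster point of these \<open>S k\<close> would lie in \<open>K0\<close> and give a contradiction.  A diagonal choice
  yields convergence on the dense sequence, and the uniform bound extends it to all points.
\<close>
lemma asymptotic_annihilating_approximants:
  fixes S :: "nat \<Rightarrow> 'a \<Rightarrow> complex^'n^'n" and D :: "nat \<Rightarrow> 'a"
  assumes C: "0 \<le> C" and S: "\<And>k. cb_norm_le V Mn C (S k)" and X: "X \<subseteq> space_carrier V"
    and SX: "\<And>x. x \<in> X \<Longrightarrow> (\<lambda>k. S k x) \<longlonglongrightarrow> 0"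
    and D: "\<And>i. D i \<in> space_carrier V"
    and dense: "\<And>y e. y \<in> space_carrier V \<Longrightarrow> e > 0 \<Longrightarrow> \<exists>i. vnorm V (y - D i) < e"
  shows "\<exists>R. \<forall>k. cb_norm_le V Mn C (R k) \<and> (\<forall>x\<in>X. R k x = 0)
    \<and> (\<forall>y\<in>space_carrier V. (\<lambda>k. S k y - R k y) \<longlonglongrightarrow> 0)"
proof -
  define K0 where "K0 = {R :: 'a \<Rightarrow> complex^'n^'n. cb_norm_le V Mn C R \<and> (\<forall>x\<in>X. R x = 0)}"
  define near where "near j k R \<longleftrightarrow> (\<forall>i\<le>j. dist (S k (D i)) (R (D i)) < inverse (Suc j))" for j k R
  have near_mono: "near j k R" if "j \<le> l" "near l k R" for j k l R
  proof -
    have "inverse (real (Suc l)) \<le> inverse (real (Suc j))"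
      using that(1) by (intro le_imp_inverse_le) auto
    moreover have "dist (S k (D i)) (R (D i)) < inverse (real (Suc l))" if "i \<le> j" for i
      using \<open>near l k R\<close> \<open>j \<le> l\<close> that unfolding near_def by simp
    ultimately show ?thesis unfolding near_def by (meson order_less_le_trans)
  qed
  have ev: "eventually (\<lambda>k. \<exists>R\<in>K0. near j k R) sequentially" for j
  proof (rule ccontr)
    assume not: "\<not> ?thesis"
    let ?bad = "{k. \<not> (\<exists>R\<in>K0. near j k R)}"
    let ?F = "inf sequentially (principal ?bad)"
    have "?F \<noteq> bot"
    proof
      assume "?F = bot"
      then have "eventually (\<lambda>_. False) ?F" by simp
      then have "eventually (\<lambda>k. k \<in> ?bad \<longrightarrow> False) sequentially"
        by (simp only: eventually_inf_principal)
      then have "eventually (\<lambda>k. \<exists>R\<in>K0. near j k R) sequentially"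
        by (rule eventually_mono) blast
      then show False using not by blast
    qed
    from cb_norm_le_cluster_point[where S = S, OF this S] obtain R G where
      G: "G \<noteq> bot" "G \<le> ?F" and R: "cb_norm_le V Mn C R"
      and lim: "\<And>y. y \<in> space_carrier V \<Longrightarrow> ((\<lambda>k. S k y) \<longlongrightarrow> R y) G" by blast
    have "G \<le> sequentially" using G(2) by simp
    then have "R x = 0" if "x \<in> X" for x
      using tendsto_unique[OF G(1) lim tendsto_mono[OF _ SX[OF that]]] that X by blast
    then have "R \<in> K0" using R by (simp add: K0_def)
    have "eventually (\<lambda>k. \<forall>i\<in>{..j}. dist (S k (D i)) (R (D i)) < inverse (Suc j)) G"
      by (intro eventually_ball_finite ballI tendstoD[OF lim[OF D]]) auto
    moreover have "eventually (\<lambda>k. k \<in> ?bad) G"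
      using G(2) by (simp add: le_principal)
    ultimately have "eventually (\<lambda>_. False) G"
    proof eventually_elim
      case (elim k)
      then have "near j k R" by (simp add: near_def)
      then show ?case using elim(2) \<open>R \<in> K0\<close> by blast
    qed
    then show False using G(1) by (simp add: eventually_False)
  qed
  \<comment> \<open>for each \<open>k\<close>, take a map that is near \<open>S k\<close> at the largest possible stage \<open>j \<le> k\<close>\<close>
  have "\<exists>R\<in>K0. \<forall>j\<le>k. (\<exists>R\<in>K0. near j k R) \<longrightarrow> near j k R" for k
  proof -
    let ?J = "{j. j \<le> k \<and> (\<exists>R\<in>K0. near j k R)}"
    have fin: "finite ?J" by simp
    show ?thesis
    proof (cases "?J = {}")
      case True
      have "(\<lambda>_. 0) \<in> K0"
        using C Mn_mnorm_le_entries[of _ "\<lambda>_ _. 0"]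
        by (fastforce simp: K0_def cb_norm_le_def linear_operator_def vec_eq_iff intro: order_trans)
      then show ?thesis using True by blast
    next
      case False
      then have "Max ?J \<in> ?J" by (intro Max_in fin)
      then obtain R where R: "R \<in> K0" "near (Max ?J) k R" by blast
      have "near j k R" if "j \<le> k" "\<exists>R\<in>K0. near j k R" for j
      proof -
        have j: "j \<le> Max ?J" using that by (intro Max_ge fin) blast
        then show ?thesis using R(2) by (rule near_mono)
      qed
      then show ?thesis using R(1) by blast
    qed
  qed
  then obtain R where RK0: "\<And>k. R k \<in> K0"
    and near: "\<And>k j. j \<le> k \<Longrightarrow> \<exists>R\<in>K0. near j k R \<Longrightarrow> near j k (R k)" by metis
  have Rcb: "cb_norm_le V Mn C (R k)" for k using RK0 by (simp add: K0_def)
  have "(\<lambda>k. S k y - R k y) \<longlonglongrightarrow> 0" if y: "y \<in> space_carrier V" for y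
  proof (rule LIMSEQ_I)
    fix r :: real assume r: "r > 0"
    define L where "L = (real CARD('n))\<^sup>2 * C"
    have L: "L \<ge> 0" using C by (simp add: L_def)
    obtain i where i: "vnorm V (y - D i) < r / (4 * (L + 1))"
      using dense[OF y, of "r / (4 * (L + 1))"] r L by auto
    have yD: "y - D i \<in> space_carrier V" by (rule carrier_diff[OF y D])
    have "L * vnorm V (y - D i) \<le> (L + 1) * (r / (4 * (L + 1)))"
      using i L vnorm_nonneg[OF yD] by (intro mult_mono) auto
    also have "\<dots> = r / 4" using L by (simp add: field_simps)
    finally have small: "norm (U (y - D i)) \<le> r / 4" if "cb_norm_le V Mn C U" for U :: "'a \<Rightarrow> complex^'n^'n"
      using cb_norm_le_norm[OF that yD] by (simp add: L_def mult.assoc)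
    obtain j0 where j0: "inverse (real (Suc j0)) < r / 2"
      using reals_Archimedean[of "r / 2"] r by auto
    define j where "j = max i j0"
    have "inverse (real (Suc j)) \<le> inverse (real (Suc j0))"
      by (intro le_imp_inverse_le) (auto simp: j_def)
    then have j: "inverse (real (Suc j)) < r / 2" using j0 by (rule order.strict_trans1)
    have ij: "i \<le> j" by (simp add: j_def)
    obtain K where K: "\<And>k. k \<ge> K \<Longrightarrow> \<exists>R\<in>K0. near j k R"
      using ev[of j] unfolding eventually_sequentially by blast
    have "norm (S k y - R k y - 0) < r" if "k \<ge> max j K" for k
    proof -
      have "near j k (R k)" using that by (intro near K) auto
      then have "norm (S k (D i) - R k (D i)) < r / 2"
        using j ij unfolding near_def dist_norm by fastforce
      moreover have "S k y - R k y = (S k (y - D i) - R k (y - D i)) + (S k (D i) - R k (D i))"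
        by (simp add: cb_norm_le_diff[OF S y D] cb_norm_le_diff[OF Rcb y D])
      moreover have "norm (S k (y - D i) - R k (y - D i)) \<le> r / 4 + r / 4"
        by (rule order_trans[OF norm_triangle_ineq4 add_mono[OF small[OF S] small[OF Rcb]]])
      ultimately show ?thesis
        using norm_triangle_ineq[of "S k (y - D i) - R k (y - D i)" "S k (D i) - R k (D i)"] by simp
    qed
    then show "\<exists>no. \<forall>k\<ge>no. norm (S k y - R k y - 0) < r" by blast
  qed
  then show ?thesis using RK0 by (intro exI[of _ R]) (simp add: K0_def)
qed

lemma separable_dense_sequence:
  assumes "separable_op_space V"
  shows "\<exists>D :: nat \<Rightarrow> 'a. (\<forall>i. D i \<in> space_carrier V) \<and>
    (\<forall>y\<in>space_carrier V. \<forall>e>0. \<exists>i. vnorm V (y - D i) < e)"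
proof -
  obtain U where U: "countable U" "U \<subseteq> space_carrier V"
    and cl: "met.mtopology closure_of U = space_carrier V"
    using assms unfolding separable_op_space_def separable_space_def by auto
  have near: "\<exists>u\<in>U. vnorm V (y - u) < e" if y: "y \<in> space_carrier V" and "e > 0" for y e
  proof -
    have "\<exists>u\<in>U. u \<in> met.mball y e"
      using y cl \<open>e > 0\<close> unfolding met.metric_closure_of by blast
    then show ?thesis by (auto simp: vdist_def)
  qed
  then have "U \<noteq> {}" using carrier_0 zero_less_one by blast
  then have r: "range (from_nat_into U) = U" using U(1) by (rule range_from_nat_into)
  show ?thesis
  proof (intro exI[of _ "from_nat_into U"] conjI allI ballI impI)
    show "from_nat_into U i \<in> space_carrier V" for i using r U(2) by blast
    show "\<exists>i. vnorm V (y - from_nat_into U i) < e" if "y \<in> space_carrier V" "e > 0" for y e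
      using near[OF that] r by (metis rangeE)
  qed
qed

end

theorem corollary2p21:
  shows "has_CSEP TYPE('y::ab_group_add) 2
    (c0_space (matrix_op_space :: (complex^'n::finite^'n) op_space))"
  unfolding has_CSEP_def
proof (intro conjI allI impI)
  let ?Z = "c0_space (Mn :: (complex^'n^'n) op_space)"
  show "operator_space ?Z" by (rule operator_space_c0[OF operator_space_Mn])
  fix Y :: "'y op_space" and X :: "'y set" and T :: "'y \<Rightarrow> nat \<Rightarrow> complex^'n^'n"
  assume *: "operator_space Y \<and> separable_op_space Y \<and> closed_linear_subspace X Y \<and>
    completely_bounded (restrict_space_to Y X) ?Z T"
  interpret M: matrix_normed_space "Mn :: (complex^'n^'n) op_space" by (rule matrix_normed_space_Mn)
  interpret Z: matrix_normed_space ?Z by (rule M.matrix_normed_space_c0)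
  interpret Y: matrix_normed_space Y using * by (simp add: operator_space_iff)
  have X: "Y.vs.subspace X" "X \<subseteq> space_carrier Y"
    using * by (auto simp: closed_linear_subspace_def)
  interpret YX: matrix_normed_space "restrict_space_to Y X" by (rule Y.restrict_matrix_normed_space[OF X])
  have Tlin: "linear_operator (restrict_space_to Y X) ?Z T"
    and bdd: "bdd_above (amplification_values (restrict_space_to Y X) ?Z T)"
    using * by (auto simp: completely_bounded_def)
  define C where "C = cb_norm (restrict_space_to Y X) ?Z T"
  \<comment> \<open>\<open>C\<close> bounds the amplifications of \<open>T\<close> on unit balls, hence those of its coordinates\<close>
  have TC: "mnorm ?Z m (\<lambda>i j. T (x i j)) \<le> C"
    if "0 < m" "x \<in> matrices_over (restrict_space_to Y X) m" "mnorm Y m x \<le> 1" for m x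
    unfolding C_def cb_norm_def
    using that by (intro cSup_upper bdd) (auto simp: amplification_values_def)
  have TZ: "(\<lambda>i j. T (x i j)) \<in> matrices_over ?Z m"
    if "x \<in> matrices_over (restrict_space_to Y X) m" for m x
    using Tlin that by (auto simp only: matrices_over_def linear_operator_def mem_Collect_eq image_subset_iff)
  have C: "0 \<le> C"
  proof -
    have "0 \<le> mnorm ?Z 1 (\<lambda>i j. T 0)"
      by (rule Z.mnorm_nonneg[OF _ TZ[OF YX.matrices_over_0]]) simp
    also have "\<dots> \<le> C"
      using TC[of 1 "\<lambda>_ _. 0"] YX.matrices_over_0 by (simp add: Y.mnorm_0)
    finally show ?thesis .
  qed
  have Tk: "cb_norm_le (restrict_space_to Y X) Mn C (\<lambda>x. T x k)" for k
    unfolding cb_norm_le_def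
  proof (intro conjI allI impI)
    show "linear_operator (restrict_space_to Y X) Mn (\<lambda>x. T x k)"
      using Tlin by (simp add: linear_operator_def)
    fix m x assume m: "0 < m" and x: "x \<in> matrices_over (restrict_space_to Y X) m"
      "mnorm (restrict_space_to Y X) m x \<le> 1"
    have "mnorm Mn m (\<lambda>i j. T (x i j) k) \<le> mnorm ?Z m (\<lambda>i j. T (x i j))"
      by (rule M.mnorm_coord_le_c0[OF m TZ[OF x(1)]])
    also have "\<dots> \<le> C" using TC[OF m x(1)] x(2) by simp
    finally show "mnorm Mn m (\<lambda>i j. T (x i j) k) \<le> C" .
  qed
  have "\<forall>k. \<exists>S. cb_norm_le Y Mn C S \<and> (\<forall>x\<in>X. S x = T x k)"
    using Y.Wittstock_extension[OF X Tk C] by blast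
  then obtain S where S: "\<And>k. cb_norm_le Y Mn C (S k)" and ST: "\<And>k x. x \<in> X \<Longrightarrow> S k x = T x k"
    by metis
  have SX: "(\<lambda>k. S k x) \<longlonglongrightarrow> 0" if x: "x \<in> X" for x
  proof -
    have "T x \<in> space_carrier ?Z" using Tlin x
      by (simp add: linear_operator_def image_subset_iff del: c0_simps)
    then have "(\<lambda>k. vnorm Mn (T x k)) \<longlonglongrightarrow> 0" by simp
    then show ?thesis
      unfolding Mn_vnorm_tendsto_0_iff by (intro vec_tendstoI) (simp add: ST x)
  qed
  have sep: "separable_op_space Y" using * by blast
  obtain D :: "nat \<Rightarrow> 'y" where D: "\<forall>i. D i \<in> space_carrier Y"
    and dense: "\<forall>y\<in>space_carrier Y. \<forall>e>0. \<exists>i. vnorm Y (y - D i) < e"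
    using Y.separable_dense_sequence[OF sep] by (elim exE conjE)
  have "\<exists>R. \<forall>k. cb_norm_le Y Mn C (R k) \<and> (\<forall>x\<in>X. R k x = 0)
      \<and> (\<forall>y\<in>space_carrier Y. (\<lambda>k. S k y - R k y) \<longlonglongrightarrow> 0)"
    by (rule Y.asymptotic_annihilating_approximants[OF C S X(2), where D = D])
       (simp_all add: SX D dense)
  then obtain R where *: "\<forall>k. cb_norm_le Y Mn C (R k) \<and> (\<forall>x\<in>X. R k x = 0)
      \<and> (\<forall>y\<in>space_carrier Y. (\<lambda>k. S k y - R k y) \<longlonglongrightarrow> 0)" by blast
  have R: "cb_norm_le Y Mn C (R k)" for k using * by blast
  have RX: "R k x = 0" if "x \<in> X" for k x using * that by blast
  have SR: "(\<lambda>k. S k y - R k y) \<longlonglongrightarrow> 0" if "y \<in> space_carrier Y" for y using * that by blast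
  define T' where "T' y = (\<lambda>k. S k y - R k y)" for y
  have T'Z: "T' y \<in> space_carrier ?Z" if "y \<in> space_carrier Y" for y
    using tendsto_vec_nth[OF tendsto_vec_nth[OF SR[OF that]]]
    by (simp add: T'_def Mn_vnorm_tendsto_0_iff)
  have T'lin: "linear_operator Y ?Z T'"
    unfolding linear_operator_def
  proof (intro conjI ballI allI)
    show "T' ` space_carrier Y \<subseteq> space_carrier ?Z" using T'Z by blast
    fix x y assume "x \<in> space_carrier Y" "y \<in> space_carrier Y"
    then show "T' (x + y) = T' x + T' y"
      using cb_norm_le_linear[OF S] cb_norm_le_linear[OF R] by (simp add: T'_def fun_eq_iff linear_operator_def)
  next
    fix c x assume "x \<in> space_carrier Y"
    then show "T' (scl Y c x) = scl ?Z c (T' x)"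
      using cb_norm_le_linear[OF S] cb_norm_le_linear[OF R]
      by (simp add: T'_def fun_eq_iff linear_operator_def M.vs.scale_right_diff_distrib)
  qed
  have T'C: "mnorm ?Z m (\<lambda>i j. T' (x i j)) \<le> 2 * C"
    if m: "0 < m" and x: "x \<in> matrices_over Y m" "mnorm Y m x \<le> 1" for m x
  proof (rule c0_mnorm_leI)
    fix k
    have "mnorm Mn m (\<lambda>i j. S k (x i j) + - R k (x i j))
        \<le> mnorm Mn m (\<lambda>i j. S k (x i j)) + mnorm Mn m (\<lambda>i j. - R k (x i j))"
      using m by (intro M.mnorm_triangle) simp_all
    also have "\<dots> \<le> C + C"
      using m cb_norm_leD[OF S m x, of k] cb_norm_leD[OF R m x, of k] by (simp add: M.mnorm_minus)
    finally show "mnorm Mn m (\<lambda>i j. T' (x i j) k) \<le> 2 * C" by (simp add: T'_def)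
  qed
  have bound: "a \<le> 2 * C" if "a \<in> amplification_values Y ?Z T'" for a
    using that T'C by (auto simp: amplification_values_def)
  have "mnorm ?Z 1 (\<lambda>i j. T' 0) \<in> amplification_values Y ?Z T'"
    unfolding amplification_values_def
    by (rule CollectI, rule exI[of _ 1], rule exI[of _ "\<lambda>_ _. 0"])
       (simp add: Y.matrices_over_0 Y.mnorm_0)
  then have "cb_norm Y ?Z T' \<le> 2 * C"
    unfolding cb_norm_def using bound by (intro cSup_least) auto
  moreover have "completely_bounded Y ?Z T'"
    unfolding completely_bounded_def by (intro conjI T'lin bdd_aboveI[of _ "2 * C"] bound)
  moreover have "\<forall>x\<in>X. T' x = T x" by (simp add: T'_def fun_eq_iff ST RX)
  ultimately show "\<exists>T'. completely_bounded Y ?Z T' \<and> (\<forall>x\<in>X. T' x = T x) \<and>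
      cb_norm Y ?Z T' \<le> 2 * cb_norm (restrict_space_to Y X) ?Z T"
    unfolding C_def by blast
qed

end
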